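(* There is a constant $C$, independent of $u$, such that the following holds. Let $u:B(0,1)\subset\mathbb{R}^2\to\mathbb{R}$ be an axisymmetric function such that, as a function of $r$, $u\in BV(0,1)$ and $\operatorname{supp}(u)\subset[0,1)$. If $\mathcal{A}u=f$, then $$\|u\|_{L^1(B(0,1))}\le C\,\|u\|_{TV(0,1)}^{1/3}\,\|f\|_{L^1(0,1)}^{2/3}.$$
   Context: $B(0,1)$ is the unit ball of $\mathbb{R}^2$. A function $u$ on $B(0,1)$ is axisymmetric if it depends only on $r=\sqrt{x^2+y^2}$; its radial profile is also written $u(r)$, and $u$ is extended by zero for $r\ge 1$. The Abel transform of $u$ is $$\mathcal{A}u(x):=2\int_x^\infty\frac{u(r)\,r}{\sqrt{r^2-x^2}}\,dr,\qquad x\ge 0 .$$ The norm on the left is $\|u\|_{L^1(B(0,1))}:=\iint_{B(0,1)}|u(x,y)|\,dx\,dy$. The total variation of the radial profile is $$\|u\|_{TV(0,1)}:=\sup\left\{\int_0^1 u(r)\,\phi'(r)\,dr:\ \phi\in C_c^1((0,1);\mathbb{R}),\ \|\phi\|_{L^\infty(0,1)}\le 1\right\}.$$ *)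

theory Defs
  imports "HOL-Analysis.Analysis"
begin

definition axisymmetric :: "(real^2 \<Rightarrow> real) \<Rightarrow> bool" where
  "axisymmetric u \<longleftrightarrow>
     (\<forall>x\<in>ball 0 1. \<forall>y\<in>ball 0 1. norm x = norm y \<longrightarrow> u x = u y)"

text \<open>The profile is read off along the positive first coordinate axis and is extended by zero
  outside \<open>[0,1)\<close>, so values of \<open>u\<close> outside the open unit disc play no role.\<close>

definition radial_profile :: "(real^2 \<Rightarrow> real) \<Rightarrow> real \<Rightarrow> real" where
  "radial_profile u r = (if 0 \<le> r \<and> r < 1 then u (r *\<^sub>R axis 1 1) else 0)"

text \<open>Including \<open>r = x\<close> is harmless: it is a null set, and the integrand is \<open>0\<close> there because
  division by zero yields zero.\<close>

definition abel_transform :: "(real \<Rightarrow> real) \<Rightarrow> real \<Rightarrow> real" where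
  "abel_transform v x = 2 * (LINT r:{x..}|lebesgue. v r * r / sqrt (r\<^sup>2 - x\<^sup>2))"

definition L1_norm :: "'a::euclidean_space set \<Rightarrow> ('a \<Rightarrow> real) \<Rightarrow> ennreal" where
  "L1_norm S g = (\<integral>\<^sup>+ x\<in>S. ennreal \<bar>g x\<bar> \<partial>lebesgue)"

text \<open>Test functions in \<open>C\<^sub>c\<^sup>1((0,1))\<close> are represented by their extensions by zero to the
  whole line.  Being continuous, they have supremum norm equal to their \<open>L\<^sup>\<infinity>\<close> norm.\<close>

definition TV_test_functions :: "(real \<Rightarrow> real) set" where
  "TV_test_functions = {\<phi>. \<phi> C1_differentiable_on UNIV \<and>
     closure {r. \<phi> r \<noteq> 0} \<subseteq> {0<..<1} \<and> (\<forall>r. \<bar>\<phi> r\<bar> \<le> 1)}"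

text \<open>Since \<open>\<phi> = 0\<close> is a test function, the supremum is nonnegative, and the truncation
  of negative integrals by \<^const>\<open>ennreal\<close> does not change it.\<close>

definition TV_norm :: "(real \<Rightarrow> real) \<Rightarrow> ennreal" where
  "TV_norm v = (SUP \<phi>\<in>TV_test_functions.
     ennreal (LINT r:{0<..<1}|lebesgue. v r * deriv \<phi> r))"

definition BV_unit_interval :: "(real \<Rightarrow> real) \<Rightarrow> bool" where
  "BV_unit_interval v \<longleftrightarrow> set_integrable lebesgue {0<..<1} v \<and> TV_norm v < \<infinity>"

text \<open>The support of an almost-everywhere class: the complement of the largest open set on which
  the function vanishes almost everywhere.  It is closed in the real line, so for a profile
  extended by zero, support in \<open>[0,1)\<close> means that the profile vanishes almost everywhere
  near \<open>1\<close>.\<close>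

definition ess_support :: "(real \<Rightarrow> real) \<Rightarrow> real set" where
  "ess_support v = {x. \<forall>U. open U \<and> x \<in> U \<longrightarrow> \<not> (AE y in lebesgue. y \<in> U \<longrightarrow> v y = 0)}"

end

theory Submission
  imports Defs
begin

text \<open>
In the variable \<open>\<rho> = r\<^sup>2\<close>, with \<open>U(\<rho>) = u(sqrt \<rho>)\<close>, the statement is one-dimensional. Planar measure
on the disc becomes \<open>pi d\<rho>\<close>; the variation is invariant under reparametrization; and the Abel
transform becomes the half integral \<open>F(y) = \<integral> U(\<rho>) / sqrt (\<rho> - y) d\<rho>\<close> over \<open>\<rho> > y\<close>, with
\<open>f(x) = F(x\<^sup>2)\<close>. Since \<open>dy = 2 x dx\<close>, the \<open>L\<^sup>1\<close> norm of \<open>F\<close> on \<open>(0,1)\<close> is at most twice that of \<open>f\<close>. What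
remains is an interpolation inequality for \<open>U\<close> between one derivative and minus one half of a
derivative, which explains the exponents: \<open>1 * 1/3 - 1/2 * 2/3 = 0\<close>.

The one-dimensional inequality is proved by duality, with a smoothing length \<open>h\<close> that is optimized at
the end. Let \<open>g\<close> be continuous with \<open>\<bar>g\<bar> \<le> 1\<close>, close to \<open>sgn U\<close>, and let \<open>g\<^sub>h\<close> be its average over
\<open>[\<rho> - h, \<rho>]\<close>.

The difference \<open>g - g\<^sub>h\<close> is the derivative of \<open>G - G\<^sub>h\<close>, where \<open>G\<close> is an antiderivative of \<open>g\<close>; this
function is bounded by \<open>h\<close> because \<open>G\<close> is 1-Lipschitz, so \<open>\<integral> U (g - g\<^sub>h) \<le> h TV(U)\<close>
(\<open>smoothing_duality\<close>).

The average \<open>g\<^sub>h\<close> is a left-sided half integral. With \<open>k(z) = 1 / sqrt z\<close> for \<open>z > 0\<close> and \<open>0\<close> otherwise, the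
convolution of \<open>k\<close> with itself is \<open>pi\<close> on the positive half-line (Abel's inversion formula), hence
\<open>pi h g\<^sub>h\<close> is the convolution of \<open>k\<close> with \<open>B\<close>, the convolution of \<open>g\<close> with \<open>k(z) - k(z - h)\<close>. The latter kernel
has \<open>L\<^sup>1\<close> norm \<open>4 sqrt h\<close>, which bounds \<open>B\<close>. Fubini gives
\<open>\<integral> U g\<^sub>h = 1 / (pi h) \<integral> F B \<le> 4 / (pi sqrt h) \<integral> \<bar>F\<bar>\<close> (\<open>half_integral_duality\<close>).

Letting \<open>g\<close> tend to \<open>sgn U\<close> gives \<open>\<integral> \<bar>U\<bar> \<le> h TV(U) + 4 / (pi sqrt h) \<integral> \<bar>F\<bar>\<close> for every \<open>h > 0\<close>
(\<open>L1_le_variation_plus_half_integral\<close>), and the best \<open>h\<close> gives the product of powers with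
\<open>C = pi (1 + 8 / pi) = pi + 8\<close> (\<open>le_powr_of_forall_tradeoff\<close>, \<open>radial_interpolation\<close>).
\<close>

section \<open>The kernel of order one half\<close>

text \<open>Both \<open>1 / sqrt z\<close> and the Beta integrand below blow up at an end of the interval of integration,
so the fundamental theorem is needed with derivative and continuity on the open interval only.\<close>

lemma has_bochner_integral_FTC_open:
  fixes f F :: "real \<Rightarrow> real"
  assumes ab: "a < b"
    and der: "\<And>x. a < x \<Longrightarrow> x < b \<Longrightarrow> (F has_real_derivative f x) (at x)"
    and cont: "\<And>x. a < x \<Longrightarrow> x < b \<Longrightarrow> isCont f x"
    and nonneg: "\<And>x. a < x \<Longrightarrow> x < b \<Longrightarrow> 0 \<le> f x"
    and F: "continuous_on {a..b} F"
  shows "has_bochner_integral lborel (\<lambda>x. indicator {a<..<b} x * f x) (F b - F a)"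
proof -
  have lim: "(F \<longlongrightarrow> F a) (at_right a)" "(F \<longlongrightarrow> F b) (at_left b)"
    using F ab by (auto simp: continuous_on_Icc_at_rightD continuous_on_Icc_at_leftD)
  have *: "set_integrable lborel (einterval (ereal a) (ereal b)) f"
    "(LBINT x=ereal a..ereal b. f x) = F b - F a"
    by (rule interval_integral_FTC_nonneg[where F=F];
        use assms lim in \<open>auto simp: ereal_tendsto_simps\<close>)+
  show ?thesis
    using * ab by (simp add: has_bochner_integral_iff set_integrable_def interval_lebesgue_integral_def
        set_lebesgue_integral_def)
qed

text \<open>Up to the constant \<open>1 / sqrt pi\<close>, convolution with this function is the Riemann--Liouville
integral of order \<open>1/2\<close>. In the variable \<open>r\<^sup>2\<close> it is the kernel of the Abel transform.\<close>

definition half_kernel :: "real \<Rightarrow> real" where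
  "half_kernel z = (if 0 < z then 1 / sqrt z else 0)"

lemma half_kernel_nonneg [simp]: "0 \<le> half_kernel z"
  by (simp add: half_kernel_def)

lemma half_kernel_measurable [measurable]: "half_kernel \<in> borel_measurable borel"
  unfolding half_kernel_def by measurable

lemma has_bochner_integral_half_kernel:
  assumes "0 < h"
  shows "has_bochner_integral lborel (\<lambda>z. indicator {0<..<h} z * half_kernel z) (2 * sqrt h)"
proof -
  have "has_bochner_integral lborel (\<lambda>z. indicator {0<..<h} z * (1 / sqrt z)) (2 * sqrt h - 2 * sqrt 0)"
    using assms
    by (intro has_bochner_integral_FTC_open) (auto intro!: derivative_eq_intros continuous_intros simp: field_simps)
  then show ?thesis
    by (rule has_bochner_integral_cong[THEN iffD1, rotated -1])
      (auto simp: half_kernel_def indicator_def)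
qed

text \<open>Each of the two terms has infinite integral at infinity; the difference is integrable because
\<open>sqrt (z - h) - sqrt z = - h / (sqrt (z - h) + sqrt z)\<close> tends to \<open>0\<close>.\<close>

lemma has_bochner_integral_half_kernel_diff_tail:
  assumes h: "0 < h"
  shows "has_bochner_integral lborel
    (\<lambda>z. indicator {h<..} z * (half_kernel (z - h) - half_kernel z)) (2 * sqrt h)"
proof -
  let ?f = "\<lambda>z. 1 / sqrt (z - h) - 1 / sqrt z" and ?F = "\<lambda>z. 2 * sqrt (z - h) - 2 * sqrt z"
  have "((\<lambda>z. - 2 * h / (sqrt (z - h) + sqrt z)) \<longlongrightarrow> 0) at_top"
    by (intro tendsto_divide_0[OF tendsto_const] filterlim_at_top_imp_at_infinity
        filterlim_at_top_add_at_top filterlim_compose[OF sqrt_at_top] filterlim_ident)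
      (simp add: filterlim_at_top_mono[OF filterlim_tendsto_add_at_top[OF tendsto_const[of "-h"] filterlim_ident]])
  moreover have "eventually (\<lambda>z. - 2 * h / (sqrt (z - h) + sqrt z) = ?F z) at_top"
    using eventually_gt_at_top[of h]
  proof eventually_elim
    case (elim z)
    then have pos: "sqrt (z - h) + sqrt z > 0"
      using h by (intro add_pos_pos) auto
    have "h = (sqrt z)\<^sup>2 - (sqrt (z - h))\<^sup>2"
      using elim h by simp
    then show ?case
      using pos by (subst \<open>h = _\<close>, intro divide_eq_imp)
        (auto simp: algebra_simps power2_eq_square)
  qed
  ultimately have lim: "(?F \<longlongrightarrow> 0) at_top"
    by (rule Lim_transform_eventually)
  have lim0: "(?F \<longlongrightarrow> ?F h) (at_right h)"
    by (intro tendsto_intros)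
  have nn: "1 / sqrt z \<le> 1 / sqrt (z - h)" if "h < z" for z
    using that h by (intro divide_left_mono mult_pos_pos) auto
  have *: "set_integrable lborel (einterval (ereal h) \<infinity>) ?f"
    "(LBINT x=ereal h..\<infinity>. ?f x) = 0 - ?F h"
    by (rule interval_integral_FTC_nonneg[where F="?F"];
        use h lim lim0 nn in \<open>auto simp: ereal_tendsto_simps intro!: derivative_eq_intros continuous_intros
          simp: field_simps\<close>)+
  have "has_bochner_integral lborel (\<lambda>z. indicator {h<..} z * ?f z) (2 * sqrt h)"
    using * by (simp add: has_bochner_integral_iff set_integrable_def interval_lebesgue_integral_def
        set_lebesgue_integral_def einterval_eq)
  then show ?thesis
    using h by (elim has_bochner_integral_cong[THEN iffD1, rotated -1])
      (auto simp: half_kernel_def indicator_def)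
qed

text \<open>This is the quantitative form of the half derivative of smoothness lost by Abel inversion:
translating the kernel by \<open>h\<close> costs only \<open>sqrt h\<close> in \<open>L\<^sup>1\<close>. The kernel decreases on \<open>{0<..}\<close>, so the
absolute value opens with one sign on either side of \<open>h\<close>.\<close>

lemma has_bochner_integral_abs_half_kernel_diff:
  assumes h: "0 < h"
  shows "has_bochner_integral lborel (\<lambda>z. \<bar>half_kernel z - half_kernel (z - h)\<bar>) (4 * sqrt h)"
proof -
  have "has_bochner_integral lborel
     (\<lambda>z. indicator {0<..<h} z * half_kernel z + indicator {h<..} z * (half_kernel (z - h) - half_kernel z))
     (2 * sqrt h + 2 * sqrt h)"
    by (intro has_bochner_integral_add has_bochner_integral_half_kernel
        has_bochner_integral_half_kernel_diff_tail h)
  moreover have "AE z in lborel. indicator {0<..<h} z * half_kernel z + indicator {h<..} z * (half_kernel (z - h) - half_kernel z)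
     = \<bar>half_kernel z - half_kernel (z - h)\<bar>"
    using AE_lborel_singleton[of h]
  proof eventually_elim
    case (elim z)
    have "half_kernel z \<le> half_kernel (z - h)" if "h < z"
      using that h by (auto simp: half_kernel_def intro!: divide_left_mono mult_pos_pos)
    then show ?case
      using elim h by (auto simp: half_kernel_def indicator_def not_less)
  qed
  ultimately show ?thesis
    by (subst has_bochner_integral_cong_AE[symmetric]) auto
qed

text \<open>Two half integrations make one integration: this is Abel's inversion formula, and amounts to
the Beta integral \<open>B(1/2, 1/2) = pi\<close>, here with the antiderivative \<open>arcsin\<close> of the integrand
after rescaling \<open>{s..r}\<close> to \<open>{-1..1}\<close>.\<close>

lemma has_bochner_integral_half_kernel_convolution:
  "has_bochner_integral lborel (\<lambda>y. half_kernel (r - y) * half_kernel (y - s)) (if s < r then pi else 0)"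
proof (cases "s < r")
  case True
  define F where "F y = arcsin ((2 * y - s - r) / (r - s))" for y
  have der: "(F has_real_derivative (1 / sqrt (r - y) * (1 / sqrt (y - s)))) (at y)" if "s < y" "y < r" for y
  proof -
    let ?t = "(2 * y - s - r) / (r - s)"
    have t: "-1 < ?t" "?t < 1"
      using that by (auto simp: field_simps)
    have "1 - ?t\<^sup>2 = (2 / (r - s))\<^sup>2 * ((r - y) * (y - s))"
    proof -
      have "1 - ?t\<^sup>2 = ((r - s)\<^sup>2 - (2 * y - s - r)\<^sup>2) / (r - s)\<^sup>2"
        by (subst diff_divide_distrib) (use True in \<open>simp add: power_divide\<close>)
      also have "(r - s)\<^sup>2 - (2 * y - s - r)\<^sup>2 = 2\<^sup>2 * ((r - y) * (y - s))"
        by (simp add: algebra_simps power2_eq_square)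
      finally show ?thesis
        by (simp add: power_divide)
    qed
    then have sq: "sqrt (1 - ?t\<^sup>2) = 2 / (r - s) * (sqrt (r - y) * sqrt (y - s))"
      using True by (simp add: real_sqrt_mult)
    have "inverse (sqrt (1 - ?t\<^sup>2)) * (2 / (r - s)) = 1 / sqrt (r - y) * (1 / sqrt (y - s))"
    proof -
      have "inverse (k * (A * B)) * k = 1 / A * (1 / B)" if "k \<noteq> 0" for k A B :: real
        using that by (simp add: divide_inverse)
      from this[of "2 / (r - s)"] show ?thesis
        unfolding sq using True by fastforce
    qed
    moreover have "((\<lambda>y. (2 * y - s - r) / (r - s)) has_real_derivative 2 / (r - s)) (at y)"
      by (rule DERIV_cdivide) (auto intro!: derivative_eq_intros)
    ultimately show ?thesis
      unfolding F_def using DERIV_chain2[where f=arcsin and g="\<lambda>y. (2 * y - s - r) / (r - s)", OF DERIV_arcsin[OF t]] by metis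
  qed
  have "has_bochner_integral lborel (\<lambda>y. indicator {s<..<r} y * (1 / sqrt (r - y) * (1 / sqrt (y - s)))) (F r - F s)"
  proof (rule has_bochner_integral_FTC_open[OF True der])
    show "continuous_on {s..r} F"
      unfolding F_def using True
      by (intro continuous_intros) (auto simp: field_simps)
  qed (auto intro!: continuous_intros)
  moreover have "F r - F s = pi"
  proof -
    have "(2 * s - s - r) / (r - s) = - 1" "(2 * r - s - r) / (r - s) = 1"
      using True by (simp_all add: divide_simps)
    then show ?thesis
      unfolding F_def by simp
  qed
  ultimately show ?thesis
    using True by (elim has_bochner_integral_cong[THEN iffD1, rotated -1])
      (auto simp: half_kernel_def indicator_def)
next
  case False
  then have z: "half_kernel (r - y) * half_kernel (y - s) = 0" for y
    by (auto simp: half_kernel_def)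
  show ?thesis
    unfolding z using False by (simp add: has_bochner_integral_zero)
qed

section \<open>Cutoffs, antiderivatives and the variation\<close>

text \<open>The function \<open>r * \<bar>r\<bar>\<close> is a \<open>C\<^sup>1\<close> replacement for \<open>r\<^sup>2\<close> that is increasing on the whole line. It
pulls test functions on \<open>(0,1)\<close> back to test functions on \<open>(0,1)\<close>, where \<open>r\<^sup>2\<close> would add a mirror
image on \<open>(-1,0)\<close>.\<close>

lemma has_real_derivative_signed_square:
  "((\<lambda>r::real. r * \<bar>r\<bar>) has_real_derivative 2 * \<bar>r\<bar>) (at r)"
proof -
  consider "r > 0" | "r < 0" | "r = 0" by linarith
  then show ?thesis
  proof cases
    case 1
    have "((\<lambda>r. r * r) has_real_derivative 2 * \<bar>r\<bar>) (at r)"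
      using 1 by (auto intro!: derivative_eq_intros)
    then show ?thesis
      by (rule has_field_derivative_transform_within_open[of _ _ _ "{0<..}"]) (use 1 in auto)
  next
    case 2
    have "((\<lambda>r. r * - r) has_real_derivative 2 * \<bar>r\<bar>) (at r)"
      using 2 by (auto intro!: derivative_eq_intros)
    then show ?thesis
      by (rule has_field_derivative_transform_within_open[of _ _ _ "{..<0}"]) (use 2 in auto)
  next
    case 3
    have "((\<lambda>h::real. \<bar>h\<bar>) \<longlongrightarrow> 0) (at 0)"
      by (auto intro!: tendsto_eq_intros)
    then have "((\<lambda>h::real. h * \<bar>h\<bar> / h) \<longlongrightarrow> 0) (at 0)"
      by (rule Lim_transform_eventually) (auto simp: eventually_at_filter)
    then show ?thesis
      using 3 by (simp add: DERIV_def)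
  qed
qed

lemma ex_C1_cutoff:
  fixes b c :: real
  assumes "b < c"
  obtains \<kappa> D where "\<And>x. (\<kappa> has_real_derivative D x) (at x)" "continuous_on UNIV D"
    "\<And>x. 0 \<le> \<kappa> x" "\<And>x. \<kappa> x \<le> 1" "\<And>x. x \<le> b \<Longrightarrow> \<kappa> x = 1" "\<And>x. c \<le> x \<Longrightarrow> \<kappa> x = 0"
proof
  \<comment> \<open>\<open>?P\<close> is twice the square of the positive part of \<open>x\<close>, so it is \<open>C\<^sup>1\<close>, vanishes for \<open>x \<le> 0\<close> and is positive for \<open>x > 0\<close>.\<close>
  let ?P = "\<lambda>x::real. x * x + x * \<bar>x\<bar>" and ?Q = "\<lambda>x::real. 2 * x + 2 * \<bar>x\<bar>"
  let ?N = "\<lambda>x. ?P (c - x)" and ?M = "\<lambda>x. ?P (x - b)"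
  define \<kappa> where "\<kappa> x = ?N x / (?N x + ?M x)" for x
  define D where "D x = (- ?Q (c - x) * (?N x + ?M x) - ?N x * (- ?Q (c - x) + ?Q (x - b)))
      / ((?N x + ?M x) * (?N x + ?M x))" for x
  have P0: "?P x = 0" if "x \<le> 0" for x :: real
    using that by simp
  have Pnn: "?P x \<ge> 0" for x :: real
    by (cases "x \<ge> 0") auto
  have Ppos: "?P x > 0" if "x > 0" for x :: real
    using that by (simp add: add_pos_pos)
  have den: "?N x + ?M x > 0" for x
  proof (cases "x < c")
    case True
    then show ?thesis using Ppos[of "c - x"] Pnn[of "x - b"] by linarith
  next
    case False
    then show ?thesis using Ppos[of "x - b"] Pnn[of "c - x"] assms by linarith
  qed
  have dP: "(?P has_real_derivative ?Q x) (at x)" for x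
    by (rule derivative_eq_intros has_real_derivative_signed_square refl | simp)+
  have dN: "(?N has_real_derivative - ?Q (c - x)) (at x)" for x
  proof -
    have "((\<lambda>x. c - x) has_real_derivative -1) (at x)"
      by (auto intro!: derivative_eq_intros)
    from DERIV_chain2[OF dP this] show ?thesis by simp
  qed
  have dM: "(?M has_real_derivative ?Q (x - b)) (at x)" for x
  proof -
    have "((\<lambda>x. x - b) has_real_derivative 1) (at x)"
      by (auto intro!: derivative_eq_intros)
    from DERIV_chain2[OF dP this] show ?thesis by simp
  qed
  show "(\<kappa> has_real_derivative D x) (at x)" for x
    unfolding \<kappa>_def D_def
    by (rule DERIV_divide[OF dN DERIV_add[OF dN dM]]) (use den[of x] in linarith)
  show "continuous_on UNIV D"
    unfolding D_def
  proof (intro continuous_intros ballI)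
    show "(?N x + ?M x) * (?N x + ?M x) \<noteq> 0" for x
      by (intro no_zero_divisors less_imp_neq[OF den, symmetric])
  qed
  show "0 \<le> \<kappa> x" for x
    unfolding \<kappa>_def by (intro divide_nonneg_pos Pnn den)
  show "\<kappa> x \<le> 1" for x
    unfolding \<kappa>_def divide_le_eq_1_pos[OF den] using Pnn[of "x - b"] by linarith
  show "\<kappa> x = 1" if "x \<le> b" for x
  proof -
    have M: "?M x = 0"
      by (rule P0) (use that in simp)
    show ?thesis
      using den[of x] assms that unfolding \<kappa>_def M by simp
  qed
  show "\<kappa> x = 0" if "c \<le> x" for x
    unfolding \<kappa>_def using P0[of "c - x"] that by simp
qed

lemma ex_antiderivative_vanishing_below:
  fixes g :: "real \<Rightarrow> real"
  assumes "continuous_on UNIV g" and "\<And>x. x \<le> d \<Longrightarrow> g x = 0"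
  obtains G where "\<And>x. (G has_real_derivative g x) (at x)" "\<And>x. x \<le> d \<Longrightarrow> G x = 0"
proof -
  have "\<exists>G. \<forall>x. -\<infinity> < ereal x \<longrightarrow> ereal x < \<infinity> \<longrightarrow> (G has_vector_derivative g x) (at x)"
    using assms(1) by (intro einterval_antiderivative) (simp_all add: continuous_on_eq_continuous_at)
  then obtain G where G: "\<And>x. (G has_real_derivative g x) (at x)"
    by (auto simp: has_real_derivative_iff_has_vector_derivative)
  have "G x = G d" if "x \<le> d" for x
  proof (cases "x < d")
    case True
    from MVT2[OF this G] obtain z where "z < d" "G d - G x = (d - x) * g z" by auto
    then show ?thesis using assms(2)[of z] by simp
  qed (use that in auto)
  then have "G x - G d = 0" if "x \<le> d" for x
    using that by (metis diff_self)
  moreover have "((\<lambda>x. G x - G d) has_real_derivative g x) (at x)" for x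
    using DERIV_diff[OF G[of x] DERIV_const[of "G d"]] by simp
  ultimately show thesis
    by (rule that[rotated])
qed

lemma lipschitz_of_bounded_derivative:
  fixes G g :: "real \<Rightarrow> real"
  assumes "\<And>x. (G has_real_derivative g x) (at x)" "\<And>x. \<bar>g x\<bar> \<le> 1"
  shows "\<bar>G x - G y\<bar> \<le> \<bar>x - y\<bar>"
  using field_differentiable_bound[of UNIV G g 1 x y] assms by simp

text \<open>Let \<open>G\<close> be an antiderivative of \<open>g\<close>. The part of \<open>g\<close> removed by averaging over \<open>{x - h..x}\<close> is the
derivative of \<open>G x - (K x - K (x - h)) / h\<close>, the difference between \<open>G\<close> and its own average. As \<open>G\<close>
is 1-Lipschitz, this function is bounded by \<open>h\<close>; divided by \<open>h\<close> and cut off to the right of the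
support of \<open>U\<close>, it is an admissible test function for the variation of \<open>U\<close>. The cutoff does not
interact with \<open>U\<close>, and its room is what the compact support of \<open>U\<close> in \<open>[0,1)\<close> provides.\<close>

lemma smoothing_duality:
  fixes U :: "real \<Rightarrow> real"
  assumes b: "0 < b" "b < 1" and U0: "\<And>x. x \<notin> {0<..<b} \<Longrightarrow> U x = 0"
    and test: "\<And>\<theta> D a c. \<lbrakk>\<And>x. (\<theta> has_real_derivative D x) (at x); continuous_on UNIV D; 0 < a; c < 1;
        \<And>x. x \<notin> {a<..<c} \<Longrightarrow> \<theta> x = 0; \<And>x. \<bar>\<theta> x\<bar> \<le> 1\<rbrakk> \<Longrightarrow> (LINT x|lborel. U x * D x) \<le> T"
    and g: "continuous_on UNIV g" "\<And>x. \<bar>g x\<bar> \<le> 1" 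
    and G: "\<And>x. (G has_real_derivative g x) (at x)"
    and d: "0 < d" "\<And>x. x \<le> d \<Longrightarrow> G x = 0" and h: "0 < h"
  shows "(LINT x|lborel. U x * (g x - (G x - G (x - h)) / h)) \<le> h * T"
proof -
  have contG: "continuous_on UNIV G"
    by (auto simp: continuous_on_eq_continuous_at intro: DERIV_isCont[OF G])
  obtain K where K: "\<And>x. (K has_real_derivative G x) (at x)" "\<And>x. x \<le> d \<Longrightarrow> K x = 0"
    by (rule ex_antiderivative_vanishing_below[where d=d, OF contG d(2)]) (assumption, rule that)
  obtain c where c: "b < c" "c < 1"
    using dense[OF b(2)] by auto
  obtain \<kappa> E where chi: "\<And>x. (\<kappa> has_real_derivative E x) (at x)" "continuous_on UNIV E"
    "\<And>x. 0 \<le> \<kappa> x" "\<And>x. \<kappa> x \<le> 1" "\<And>x. x \<le> b \<Longrightarrow> \<kappa> x = 1" "\<And>x. c \<le> x \<Longrightarrow> \<kappa> x = 0"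
    by (rule ex_C1_cutoff[OF c(1)]) (rule that)
  have E0: "E x = 0" if "x < b" for x
  proof -
    have "((\<lambda>_. 1) has_real_derivative E x) (at x)"
      by (rule has_field_derivative_transform_within_open[OF chi(1), of "{..<b}"]) (use that chi(5) in auto)
    then show ?thesis
      by (rule DERIV_unique) (rule DERIV_const)
  qed
  define \<eta> where "\<eta> x = (G x - (K x - K (x - h)) / h) / h" for x
  define \<eta>' where "\<eta>' x = (g x - (G x - G (x - h)) / h) / h" for x
  have d\<eta>: "(\<eta> has_real_derivative \<eta>' x) (at x)" for x
  proof -
    have "((\<lambda>x. K (x - h)) has_real_derivative G (x - h)) (at x)"
    proof -
      have "((\<lambda>x. x - h) has_real_derivative 1) (at x)"
        by (auto intro!: derivative_eq_intros)
      from DERIV_chain2[OF K(1) this] show ?thesis by simp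
    qed
    then show ?thesis
      unfolding \<eta>_def \<eta>'_def by (intro DERIV_cdivide DERIV_diff K G)
  qed
  have \<eta>le: "\<bar>\<eta> x\<bar> \<le> 1" for x
  proof -
    have "\<exists>z. x - h < z \<and> z < x \<and> K x - K (x - h) = (x - (x - h)) * G z"
      by (rule MVT2) (use h K(1) in simp_all)
    then obtain z where z: "x - h < z" "z < x" "K x - K (x - h) = h * G z"
      by auto
    have "\<bar>G x - G z\<bar> \<le> \<bar>x - z\<bar>"
      by (rule lipschitz_of_bounded_derivative[OF G g(2)])
    also have "\<dots> \<le> h"
      using z by simp
    finally have "\<bar>G x - G z\<bar> / h \<le> 1"
      using h by simp
    moreover have "\<eta> x = (G x - G z) / h"
      unfolding \<eta>_def z(3) using h by simp
    ultimately show ?thesis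
      using h by simp
  qed
  have contK: "continuous_on UNIV K" and cont\<kappa>: "continuous_on UNIV \<kappa>"
    by (auto simp: continuous_on_eq_continuous_at intro: DERIV_isCont[OF K(1)] DERIV_isCont[OF chi(1)])
  have shift: "continuous_on UNIV (\<lambda>x. f (x - h))" if "continuous_on UNIV f" for f :: "real \<Rightarrow> real"
    by (rule continuous_on_compose2[OF that]) (auto intro!: continuous_intros)
  have cont: "continuous_on UNIV (\<lambda>x. \<eta>' x * \<kappa> x + E x * \<eta> x)"
    unfolding \<eta>_def \<eta>'_def
    by (intro continuous_intros g(1) contG contK shift[OF contG] shift[OF contK] chi(2) cont\<kappa>) (use h in auto)
  have "(LINT x|lborel. U x * (\<eta>' x * \<kappa> x + E x * \<eta> x)) \<le> T"
  proof (rule test[where \<theta>="\<lambda>x. \<eta> x * \<kappa> x", OF _ cont d(1) c(2)])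
    show "((\<lambda>x. \<eta> x * \<kappa> x) has_real_derivative (\<eta>' x * \<kappa> x + E x * \<eta> x)) (at x)" for x
      by (rule DERIV_mult[OF d\<eta> chi(1)])
    show "\<eta> x * \<kappa> x = 0" if "x \<notin> {d<..<c}" for x
    proof (cases "x \<le> d")
      case True
      then show ?thesis
        using d(2)[of x] K(2)[of x] K(2)[of "x - h"] h by (simp add: \<eta>_def)
    next
      case False
      then show ?thesis
        using that chi(6)[of x] by simp
    qed
    show "\<bar>\<eta> x * \<kappa> x\<bar> \<le> 1" for x
      using mult_mono[OF \<eta>le[of x] chi(4)[of x]] chi(3)[of x] by (simp add: abs_mult)
  qed
  also have "(\<lambda>x. U x * (\<eta>' x * \<kappa> x + E x * \<eta> x)) = (\<lambda>x. U x * (g x - (G x - G (x - h)) / h) / h)"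
  proof
    show "U x * (\<eta>' x * \<kappa> x + E x * \<eta> x) = U x * (g x - (G x - G (x - h)) / h) / h" for x
    proof (cases "x \<in> {0<..<b}")
      case True
      then show ?thesis
        using E0[of x] chi(5)[of x] by (simp add: \<eta>'_def)
    next
      case False
      then show ?thesis
        using U0[OF False] by simp
    qed
  qed
  finally show ?thesis
    using h by (simp add: field_simps)
qed

section \<open>Abel inversion by duality\<close>

lemma lborel_reflect:
  fixes f :: "real \<Rightarrow> real"
  shows "(LINT y|lborel. f (x - y)) = (LINT y|lborel. f y)"
    and "integrable lborel f \<Longrightarrow> integrable lborel (\<lambda>y. f (x - y))"
  using lborel_integral_real_affine[of "-1" f x] lborel_integrable_real_affine[of f "-1" x] by simp_all

text \<open>By Tonelli the \<open>L\<^sup>1\<close> norm is at most \<open>M\<close> times the norms of \<open>p\<close> and \<open>k\<close>, as reflection and translation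
preserve the norm of \<open>k\<close>. The exchanges of integrals below rest on this.\<close>

lemma integrable_convolution_kernel:
  fixes p k g :: "real \<Rightarrow> real"
  assumes p: "integrable lborel p" and k: "integrable lborel k"
    and g[measurable]: "g \<in> borel_measurable borel" and M: "\<And>y. \<bar>g y\<bar> \<le> M"
  shows "integrable (lborel \<Otimes>\<^sub>M lborel) (\<lambda>(x, y). p x * (g y * k (x - y)))"
proof -
  have [measurable]: "p \<in> borel_measurable borel" "k \<in> borel_measurable borel"
    using p k by (auto dest: borel_measurable_integrable)
  have int_y: "integrable lborel (\<lambda>y. g y * k (x - y))" for x
  proof (rule Bochner_Integration.integrable_bound)
    show "integrable lborel (\<lambda>y. M * \<bar>k (x - y)\<bar>)"
      by (intro integrable_mult_right integrable_abs lborel_reflect k)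
    show "AE y in lborel. norm (g y * k (x - y)) \<le> norm (M * \<bar>k (x - y)\<bar>)"
      using M order_trans[OF abs_ge_zero M] by (auto simp: abs_mult intro!: mult_right_mono)
  qed simp
  have bound: "(LINT y|lborel. \<bar>g y * k (x - y)\<bar>) \<le> M * (LINT z|lborel. \<bar>k z\<bar>)" for x
  proof -
    have "(LINT y|lborel. \<bar>g y * k (x - y)\<bar>) \<le> (LINT y|lborel. M * \<bar>k (x - y)\<bar>)"
      using M by (intro integral_mono integrable_abs int_y integrable_mult_right lborel_reflect k)
        (auto simp: abs_mult intro!: mult_right_mono)
    also have "\<dots> = M * (LINT z|lborel. \<bar>k z\<bar>)"
      using lborel_reflect(1)[of "\<lambda>z. \<bar>k z\<bar>" x] by simp
    finally show ?thesis .
  qed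
  show ?thesis
  proof (rule lborel_pair.Fubini_integrable)
    show "AE x in lborel. integrable lborel (\<lambda>y. case (x, y) of (x, y) \<Rightarrow> p x * (g y * k (x - y)))"
      using int_y by auto
    show "integrable lborel (\<lambda>x. LINT y|lborel. norm (case (x, y) of (x, y) \<Rightarrow> p x * (g y * k (x - y))))"
    proof (rule Bochner_Integration.integrable_bound)
      show "integrable lborel (\<lambda>x. \<bar>p x\<bar> * (M * (LINT z|lborel. \<bar>k z\<bar>)))"
        using p by simp
      show "AE x in lborel. norm (LINT y|lborel. norm (case (x, y) of (x, y) \<Rightarrow> p x * (g y * k (x - y))))
        \<le> norm (\<bar>p x\<bar> * (M * (LINT z|lborel. \<bar>k z\<bar>)))"
      proof (rule AE_I2)
        fix x
        have "(LINT y|lborel. norm (case (x, y) of (x, y) \<Rightarrow> p x * (g y * k (x - y))))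
          = \<bar>p x\<bar> * (LINT y|lborel. \<bar>g y * k (x - y)\<bar>)"
          by (simp add: abs_mult)
        also have "\<dots> \<le> \<bar>p x\<bar> * (M * (LINT z|lborel. \<bar>k z\<bar>))"
          by (intro mult_left_mono bound) simp
        finally show "norm (LINT y|lborel. norm (case (x, y) of (x, y) \<Rightarrow> p x * (g y * k (x - y))))
        \<le> norm (\<bar>p x\<bar> * (M * (LINT z|lborel. \<bar>k z\<bar>)))"
          by simp
      qed
    qed simp
  qed simp
qed

text \<open>Solves the Abel equation for an averaged right-hand side: up to the factor \<open>pi * h\<close>, the average
of \<open>g\<close> over \<open>{r - h..r}\<close> is the half integral of \<open>B\<close>, because the convolution of the half kernel with
\<open>k\<close> is \<open>pi\<close> on \<open>{0<..h}\<close> and \<open>0\<close> elsewhere. The bound on \<open>B\<close> is the \<open>L\<^sup>1\<close> norm of \<open>k\<close>.\<close>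

lemma half_kernel_smoothing:
  fixes g G :: "real \<Rightarrow> real" and h r :: real
  defines "k \<equiv> \<lambda>z. half_kernel z - half_kernel (z - h)"
  defines "B \<equiv> \<lambda>y. LINT s|lborel. g s * k (y - s)"
  assumes g: "continuous_on UNIV g" "\<And>x. \<bar>g x\<bar> \<le> 1"
    and G: "\<And>x. (G has_real_derivative g x) (at x)"
    and g0: "\<And>x. x \<le> 0 \<Longrightarrow> g x = 0" and h: "0 < h"
  shows "B \<in> borel_measurable borel" and "\<bar>B y\<bar> \<le> 4 * sqrt h"
    and "r \<le> 1 \<Longrightarrow> (LINT y|lborel. indicator {0<..<1} y * half_kernel (r - y) * B y) = pi * (G r - G (r - h))"
proof -
  have [measurable]: "g \<in> borel_measurable borel"
    using g(1) by (rule borel_measurable_continuous_onI)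
  have [measurable]: "k \<in> borel_measurable borel"
    unfolding k_def by measurable
  have absk: "has_bochner_integral lborel (\<lambda>z. \<bar>k z\<bar>) (4 * sqrt h)"
    unfolding k_def by (rule has_bochner_integral_abs_half_kernel_diff[OF h])
  then have k: "integrable lborel k"
    using integrable_abs_iff[of k lborel] by (simp add: has_bochner_integral_iff)
  show "B \<in> borel_measurable borel"
    unfolding B_def by measurable
  show "\<bar>B y\<bar> \<le> 4 * sqrt h"
  proof -
    have absk': "integrable lborel (\<lambda>s. \<bar>k (y - s)\<bar>)"
      by (intro integrable_abs lborel_reflect k)
    have le: "\<bar>g s * k (y - s)\<bar> \<le> \<bar>k (y - s)\<bar>" for s
      using mult_right_mono[OF g(2) abs_ge_zero] by (simp add: abs_mult)
    have "norm (B y) \<le> (LINT s|lborel. \<bar>k (y - s)\<bar>)"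
      unfolding B_def
    proof (rule Bochner_Integration.integral_norm_bound_integral)
      show "integrable lborel (\<lambda>s. g s * k (y - s))"
        by (rule Bochner_Integration.integrable_bound[OF absk']) (use le in auto)
    qed (use absk' le in auto)
    then have "\<bar>B y\<bar> \<le> (LINT s|lborel. \<bar>k (y - s)\<bar>)"
      by simp
    also have "\<dots> = 4 * sqrt h"
      using lborel_reflect(1)[of "\<lambda>z. \<bar>k z\<bar>" y] absk by (simp add: has_bochner_integral_iff)
    finally show ?thesis .
  qed
  assume r: "r \<le> 1"
  define p where "p y = indicator {0<..<1} y * half_kernel (r - y)" for y
  have [measurable]: "p \<in> borel_measurable borel"
    unfolding p_def by measurable
  have p: "integrable lborel p"
  proof (rule Bochner_Integration.integrable_bound)
    show "integrable lborel (\<lambda>y. indicator {0<..<1} (r - y) * half_kernel (r - y))"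
      using lborel_reflect(2)[of "\<lambda>z. indicator {0<..<1} z * half_kernel z" r] 
        has_bochner_integral_half_kernel[of 1]
      by (simp add: has_bochner_integral_iff)
    show "AE y in lborel. norm (p y) \<le> norm (indicator {0<..<1} (r - y) * half_kernel (r - y))"
      using r by (auto simp: p_def indicator_def half_kernel_def)
  qed simp
  have prod: "integrable (lborel \<Otimes>\<^sub>M lborel) (\<lambda>(y, s). p y * (g s * k (y - s)))"
    by (rule integrable_convolution_kernel[OF p k _ g(2)]) simp
  have "(LINT y|lborel. p y * B y) = (LINT y|lborel. LINT s|lborel. p y * (g s * k (y - s)))"
    unfolding B_def by simp
  also have "\<dots> = (LINT s|lborel. LINT y|lborel. p y * (g s * k (y - s)))"
    using lborel_pair.Fubini_integral[OF prod] by simp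
  also have "\<dots> = (LINT s|lborel. pi * (g s * indicator {r - h..r} s))"
  proof (rule integral_cong_AE)
    show "AE s in lborel. (LINT y|lborel. p y * (g s * k (y - s))) = pi * (g s * indicator {r - h..r} s)"
      using AE_lborel_singleton[of "r - h"] AE_lborel_singleton[of r]
    proof eventually_elim
      case (elim s)
      show ?case
      proof (cases "s \<le> 0")
        case True
        then show ?thesis by (simp add: g0)
      next
        case False
        have conv: "has_bochner_integral lborel (\<lambda>y. half_kernel (r - y) * half_kernel (y - s)
            - half_kernel (r - y) * half_kernel (y - (s + h)))
            ((if s < r then pi else 0) - (if s + h < r then pi else 0))"
          by (intro has_bochner_integral_diff has_bochner_integral_half_kernel_convolution)
        \<comment> \<open>For \<open>0 < s\<close> and \<open>r \<le> 1\<close> the product is supported in \<open>0 < s < y < r \<le> 1\<close>, so the indicator in \<open>p\<close> is invisible.\<close>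
        have "p y * k (y - s) = half_kernel (r - y) * half_kernel (y - s)
            - half_kernel (r - y) * half_kernel (y - (s + h))" for y
        proof (cases "s < y \<and> y < r")
          case True
          then show ?thesis
            using False r by (simp add: p_def k_def algebra_simps)
        next
          case False
          then show ?thesis
            using h by (auto simp: p_def k_def half_kernel_def)
        qed
        then have "(LINT y|lborel. p y * k (y - s)) = (if s < r then pi else 0) - (if s + h < r then pi else 0)"
          using conv by (simp add: has_bochner_integral_iff)
        also have "\<dots> = pi * indicator {r - h..r} s"
          using elim h by (auto simp: indicator_def)
        finally have "g s * (LINT y|lborel. p y * k (y - s)) = g s * (pi * indicator {r - h..r} s)"
          by simp
        moreover have "(LINT y|lborel. p y * (g s * k (y - s))) = (LINT y|lborel. g s * (p y * k (y - s)))"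
          by (simp add: mult_ac)
        ultimately show ?thesis
          by (simp add: mult_ac)
      qed
    qed
  qed simp_all
  also have "\<dots> = pi * (G r - G (r - h))"
  proof -
    have "(LINT s|lborel. g s * indicator {r - h..r} s) = G r - G (r - h)"
      using h g(1) by (intro integral_FTC_Icc_real G) (auto simp: continuous_on_eq_continuous_at)
    then show ?thesis by simp
  qed
  finally show "(LINT y|lborel. indicator {0<..<1} y * half_kernel (r - y) * B y) = pi * (G r - G (r - h))"
    unfolding p_def .
qed

text \<open>The right-sided half integral, which is the Abel transform in the variable \<open>r\<^sup>2\<close>.\<close>

definition half_integral :: "(real \<Rightarrow> real) \<Rightarrow> real \<Rightarrow> real" where
  "half_integral U y = (LINT r|lborel. U r * half_kernel (r - y))"

text \<open>The adjoint of the right-sided half integral is the left-sided one, so Fubini moves the half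
integration in the averaged test function from \<open>B\<close> onto \<open>U\<close>.\<close>

lemma half_integral_duality:
  fixes U g G :: "real \<Rightarrow> real"
  assumes U: "integrable lborel U" and U0: "\<And>x. x \<notin> {0<..<1} \<Longrightarrow> U x = 0"
    and g: "continuous_on UNIV g" "\<And>x. \<bar>g x\<bar> \<le> 1"
    and G: "\<And>x. (G has_real_derivative g x) (at x)"
    and g0: "\<And>x. x \<le> 0 \<Longrightarrow> g x = 0" and h: "0 < h"
  shows "(LINT x|lborel. U x * (G x - G (x - h)))
      \<le> 4 / pi * sqrt h * (LINT y|lborel. indicator {0<..<1} y * \<bar>half_integral U y\<bar>)"
proof -
  have [measurable]: "U \<in> borel_measurable borel"
    using U by (auto dest: borel_measurable_integrable)
  \<comment> \<open>Truncating the half kernel makes it integrable and changes nothing while \<open>x - y < 1\<close>.\<close>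
  define k where "k z = indicator {0<..<1} z * half_kernel z" for z
  have k: "integrable lborel k"
    using has_bochner_integral_half_kernel[of 1] by (simp add: k_def[abs_def] has_bochner_integral_iff)
  define B where "B y = (LINT s|lborel. g s * (half_kernel (y - s) - half_kernel (y - s - h)))" for y
  note B = half_kernel_smoothing[OF g G g0 h, folded B_def]
  have [measurable]: "B \<in> borel_measurable borel"
    by (rule B(1))
  have Uk: "U x * (indicator {0<..<1} y * k (x - y)) = indicator {0<..<1} y * (U x * half_kernel (x - y))" for x y
    using U0[of x] by (auto simp: k_def indicator_def half_kernel_def)
  have "integrable (lborel \<Otimes>\<^sub>M lborel) (\<lambda>(x, y). U x * (indicator {0<..<1} y * k (x - y)))"
    by (rule integrable_convolution_kernel[OF U k, of _ 1]) (auto simp: indicator_def)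
  then have "integrable lborel (\<lambda>y. LINT x|lborel. U x * (indicator {0<..<1} y * k (x - y)))"
    by (rule lborel_pair.integrable_snd)
  then have int: "integrable lborel (\<lambda>y. indicator {0<..<1} y * half_integral U y)"
    unfolding Uk half_integral_def by simp
  have prod: "integrable (lborel \<Otimes>\<^sub>M lborel) (\<lambda>(x, y). U x * ((indicator {0<..<1} y * B y) * k (x - y)))"
    by (rule integrable_convolution_kernel[OF U k, of _ "4 * sqrt h"]) (use B(2) h in \<open>auto simp: indicator_def\<close>)
  have Uk': "U x * ((indicator {0<..<1} y * B y) * k (x - y)) =
      indicator {0<..<1} y * B y * (U x * half_kernel (x - y))" for x y
    using Uk[of x y] by (simp add: mult_ac) 
  have "pi * (LINT x|lborel. U x * (G x - G (x - h))) = (LINT x|lborel. U x * (pi * (G x - G (x - h))))"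
    by (simp add: mult_ac)
  also have "\<dots> = (LINT x|lborel. LINT y|lborel. U x * ((indicator {0<..<1} y * B y) * k (x - y)))"
  proof (rule Bochner_Integration.integral_cong[OF refl])
    fix x
    show "U x * (pi * (G x - G (x - h))) = (LINT y|lborel. U x * ((indicator {0<..<1} y * B y) * k (x - y)))"
    proof (cases "x \<in> {0<..<1}")
      case True
      then have "U x * (pi * (G x - G (x - h))) = U x * (LINT y|lborel. indicator {0<..<1} y * half_kernel (x - y) * B y)"
        by (subst B(3)) auto
      also have "\<dots> = (LINT y|lborel. indicator {0<..<1} y * B y * (U x * half_kernel (x - y)))"
        by (simp flip: integral_mult_right_zero add: mult_ac)
      finally show ?thesis
        unfolding Uk' .
    qed (simp add: U0)
  qed
  also have "\<dots> = (LINT y|lborel. LINT x|lborel. U x * ((indicator {0<..<1} y * B y) * k (x - y)))"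
    using lborel_pair.Fubini_integral[OF prod] by simp
  also have "\<dots> = (LINT y|lborel. indicator {0<..<1} y * B y * half_integral U y)"
    unfolding Uk' half_integral_def by simp
  also have "\<dots> \<le> (LINT y|lborel. 4 * sqrt h * (indicator {0<..<1} y * \<bar>half_integral U y\<bar>))"
  proof (rule integral_mono)
    have abs_int: "integrable lborel (\<lambda>y. indicator {0<..<1} y * \<bar>half_integral U y\<bar>)"
      using integrable_abs[OF int] by (simp add: abs_mult)
    then show "integrable lborel (\<lambda>y. 4 * sqrt h * (indicator {0<..<1} y * \<bar>half_integral U y\<bar>))"
      by simp
    have "integrable lborel (\<lambda>y. LINT x|lborel. U x * ((indicator {0<..<1} y * B y) * k (x - y)))"
      by (rule lborel_pair.integrable_snd[OF prod])
    then show "integrable lborel (\<lambda>y. indicator {0<..<1} y * B y * half_integral U y)"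
      unfolding Uk' half_integral_def by simp
    show "indicator {0<..<1} y * B y * half_integral U y \<le> 4 * sqrt h * (indicator {0<..<1} y * \<bar>half_integral U y\<bar>)" for y
    proof -
      have "B y * half_integral U y \<le> \<bar>B y\<bar> * \<bar>half_integral U y\<bar>"
        by (metis abs_ge_self abs_mult)
      also have "\<dots> \<le> 4 * sqrt h * \<bar>half_integral U y\<bar>"
        by (rule mult_right_mono[OF B(2) abs_ge_zero])
      finally show ?thesis
        by (simp add: indicator_def)
    qed
  qed
  finally have "pi * (LINT x|lborel. U x * (G x - G (x - h)))
      \<le> 4 * sqrt h * (LINT y|lborel. indicator {0<..<1} y * \<bar>half_integral U y\<bar>)"
    unfolding integral_mult_right_zero .
  moreover have "a \<le> 4 / pi * sqrt h * c" if "pi * a \<le> 4 * sqrt h * c" for a c :: real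
    using that by (simp add: field_simps)
  ultimately show "(LINT x|lborel. U x * (G x - G (x - h)))
      \<le> 4 / pi * sqrt h * (LINT y|lborel. indicator {0<..<1} y * \<bar>half_integral U y\<bar>)"
    by blast
qed

section \<open>The one-dimensional estimate\<close>

text \<open>A bounded measurable function is an almost everywhere limit of continuous ones; clipping them to
\<open>{-1..1}\<close> and multiplying by a ramp keeps the limit on \<open>{0<..}\<close>. The ramp makes the
antiderivative vanish near \<open>0\<close>, as a test function on \<open>(0,1)\<close> must.\<close>

lemma ex_continuous_approximation_of_sign:
  fixes U :: "real \<Rightarrow> real"
  assumes U[measurable]: "U \<in> borel_measurable borel"
  obtains g :: "nat \<Rightarrow> real \<Rightarrow> real" where
    "\<And>n. continuous_on UNIV (g n)" "\<And>n x. \<bar>g n x\<bar> \<le> 1" "\<And>n x. x \<le> 1 / real (Suc n) \<Longrightarrow> g n x = 0"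
    "AE x in lborel. 0 < x \<longrightarrow> (\<lambda>n. g n x) \<longlonglongrightarrow> sgn (U x)"
proof -
  have "(\<lambda>x. sgn (U x)) \<in> borel_measurable (lebesgue_on UNIV)"
    by (simp add: borel_measurable_if_D measurable_completion)
  then have "(\<lambda>x. sgn (U x)) measurable_on UNIV"
    by (subst measurable_on_iff_borel_measurable) auto
  then obtain N f where N: "negligible N" and f: "\<And>n. continuous_on UNIV (f n)"
    and lim: "\<And>x. x \<notin> N \<Longrightarrow> (\<lambda>n. f n x) \<longlonglongrightarrow> sgn (U x)"
    by (auto simp: measurable_on_def)
  define cut :: "nat \<Rightarrow> real \<Rightarrow> real" where "cut n x = max 0 (min 1 (real n * x - 1))" for n x
  define g where "g n x = max (- 1) (min 1 (f n x)) * cut n x" for n x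
  show thesis
  proof (rule that)
    show "continuous_on UNIV (g n)" for n
      unfolding g_def cut_def by (intro continuous_intros f)
    show "\<bar>g n x\<bar> \<le> 1" for n x
    proof -
      have "\<bar>max (- 1) (min 1 (f n x))\<bar> \<le> 1" "\<bar>cut n x\<bar> \<le> 1"
        by (auto simp: cut_def)
      then have "\<bar>max (- 1) (min 1 (f n x))\<bar> * \<bar>cut n x\<bar> \<le> 1 * 1"
        by (intro mult_mono) simp_all
      then show ?thesis
        by (simp add: g_def abs_mult)
    qed
    show "g n x = 0" if "x \<le> 1 / real (Suc n)" for n x
    proof -
      have "real n * x \<le> real n * (1 / real (Suc n))"
        by (intro mult_left_mono that) simp
      also have "\<dots> \<le> 1"
        by (simp add: field_simps)
      finally show ?thesis
        by (simp add: g_def cut_def)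
    qed
    have "AE x in lebesgue. x \<notin> N"
      using N by (auto simp: negligible_iff_null_sets intro: AE_not_in)
    then have "AE x in lborel. x \<notin> N"
      by (simp add: AE_completion_iff)
    then show "AE x in lborel. 0 < x \<longrightarrow> (\<lambda>n. g n x) \<longlonglongrightarrow> sgn (U x)"
    proof eventually_elim
      case (elim x)
      show ?case
      proof
        assume x: "0 < x"
        have "eventually (\<lambda>n. real n \<ge> 2 / x) sequentially"
          using eventually_ge_at_top[of "nat \<lceil>2 / x\<rceil>"] by eventually_elim linarith
        then have "eventually (\<lambda>n. 1 = cut n x) sequentially"
          by eventually_elim (use x in \<open>auto simp: cut_def field_simps\<close>)
        then have "(\<lambda>n. cut n x) \<longlonglongrightarrow> 1"
          by (rule Lim_transform_eventually[OF tendsto_const])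
        then have "(\<lambda>n. g n x) \<longlonglongrightarrow> max (- 1) (min 1 (sgn (U x))) * 1"
          unfolding g_def by (intro tendsto_intros lim elim)
        moreover have "max (- 1) (min 1 (sgn (U x))) = sgn (U x)"
          by (auto simp: sgn_if)
        ultimately show "(\<lambda>n. g n x) \<longlonglongrightarrow> sgn (U x)"
          by simp
      qed
    qed
  qed
qed

text \<open>Test \<open>U\<close> against \<open>g\<close> close to \<open>sgn U\<close>, and split \<open>g\<close> into its average over \<open>{x - h..x}\<close>, controlled by the
half integral, and the remainder, controlled by the variation.\<close>

lemma L1_le_variation_plus_half_integral:
  fixes U :: "real \<Rightarrow> real"
  assumes U: "integrable lborel U" and b: "0 < b" "b < 1" and U0: "\<And>x. x \<notin> {0<..<b} \<Longrightarrow> U x = 0"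
    and test: "\<And>\<theta> D a c. \<lbrakk>\<And>x. (\<theta> has_real_derivative D x) (at x); continuous_on UNIV D; 0 < a; c < 1;
        \<And>x. x \<notin> {a<..<c} \<Longrightarrow> \<theta> x = 0; \<And>x. \<bar>\<theta> x\<bar> \<le> 1\<rbrakk> \<Longrightarrow> (LINT x|lborel. U x * D x) \<le> T"
    and h: "0 < h"
  shows "(LINT x|lborel. \<bar>U x\<bar>) \<le> h * T
      + 4 / pi / sqrt h * (LINT y|lborel. indicator {0<..<1} y * \<bar>half_integral U y\<bar>)" (is "_ \<le> ?R")
proof -
  have [measurable]: "U \<in> borel_measurable borel"
    using U by (auto dest: borel_measurable_integrable)
  have U1: "U x = 0" if "x \<notin> {0<..<1}" for x
    using U0[of x] that b by auto
  obtain g where g: "\<And>n. continuous_on UNIV (g n)" "\<And>n x. \<bar>g n x\<bar> \<le> 1"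
      "\<And>n x. x \<le> 1 / real (Suc n) \<Longrightarrow> g n x = 0"
    and lim: "AE x in lborel. 0 < x \<longrightarrow> (\<lambda>n. g n x) \<longlonglongrightarrow> sgn (U x)"
    by (rule ex_continuous_approximation_of_sign[of U]) (auto intro: that)
  have [measurable]: "g n \<in> borel_measurable borel" for n
    using g(1) by (rule borel_measurable_continuous_onI)
  have le: "norm (U x * a) \<le> norm (U x)" if "\<bar>a\<bar> \<le> 1" for x a
    using mult_left_mono[OF that abs_ge_zero[of "U x"]] by (simp add: abs_mult)
  have bound: "(LINT x|lborel. U x * g n x) \<le> ?R" for n
  proof -
    obtain G where G: "\<And>x. (G has_real_derivative g n x) (at x)" "\<And>x. x \<le> 1 / real (Suc n) \<Longrightarrow> G x = 0"
      by (rule ex_antiderivative_vanishing_below[where d="1 / real (Suc n)" and g="g n", OF g(1,3)])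
        (assumption, rule that)
    have "continuous_on UNIV G"
      by (auto simp: continuous_on_eq_continuous_at intro: DERIV_isCont[OF G(1)])
    then have [measurable]: "G \<in> borel_measurable borel"
      by (rule borel_measurable_continuous_onI)
    let ?S = "(LINT y|lborel. indicator {0<..<1} y * \<bar>half_integral U y\<bar>)"
    let ?A = "\<lambda>x. (G x - G (x - h)) / h"
    have A1: "\<bar>?A x\<bar> \<le> 1" for x
      using lipschitz_of_bounded_derivative[OF G(1) g(2), of x "x - h"] h by simp
    have intA: "integrable lborel (\<lambda>x. U x * ?A x)"
      by (rule Bochner_Integration.integrable_bound[OF U]) (measurable, intro AE_I2 le A1)
    have intg: "integrable lborel (\<lambda>x. U x * g n x)"
      by (rule Bochner_Integration.integrable_bound[OF U]) (measurable, intro AE_I2 le g(2))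
    have "(LINT x|lborel. U x * (g n x - ?A x)) \<le> h * T"
    proof (rule smoothing_duality[where g="g n" and G=G and d="1 / real (Suc n)" and b=b])
      show "(LINT x|lborel. U x * D x) \<le> T"
        if "\<And>x. (\<theta> has_real_derivative D x) (at x)" "continuous_on UNIV D" "0 < a" "c < 1"
          "\<And>x. x \<notin> {a<..<c} \<Longrightarrow> \<theta> x = 0" "\<And>x. \<bar>\<theta> x\<bar> \<le> 1" for \<theta> D a c
        by (rule test[OF that])
      show "\<bar>g n x\<bar> \<le> 1" "(G has_real_derivative g n x) (at x)" for x
        by (rule g(2) G(1))+
    qed (rule b U0 g(1) G(2) h | assumption | simp)+
    moreover have "(LINT x|lborel. U x * (g n x - ?A x)) = (LINT x|lborel. U x * g n x) - (LINT x|lborel. U x * ?A x)"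
      using intA intg by (simp add: right_diff_distrib)
    moreover have "(LINT x|lborel. U x * ?A x) = (LINT x|lborel. U x * (G x - G (x - h))) / h"
      by simp
    moreover have "(LINT x|lborel. U x * (G x - G (x - h))) / h
      \<le> (4 / pi * sqrt h * (LINT y|lborel. indicator {0<..<1} y * \<bar>half_integral U y\<bar>)) / h"
    proof (rule divide_right_mono)
      have g0: "g n x = 0" if "x \<le> 0" for x
        using that by (intro g(3)) (simp add: order_trans[of x 0])
      show "(LINT x|lborel. U x * (G x - G (x - h)))
        \<le> 4 / pi * sqrt h * (LINT y|lborel. indicator {0<..<1} y * \<bar>half_integral U y\<bar>)"
        by (rule half_integral_duality[where g="g n"]) (rule U U1 g G(1) g0 h; assumption)+
    qed (use h in simp)
    moreover have "(4 / pi * sqrt h * ?S) / h = 4 / pi / sqrt h * ?S"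
    proof -
      have eq: "sqrt h / h = 1 / sqrt h"
        using h by (simp add: field_simps)
      have "(4 / pi * sqrt h * ?S) / h = 4 / pi * ?S * (sqrt h / h)"
        by simp
      then show ?thesis
        unfolding eq by simp
    qed
    ultimately show ?thesis
      by linarith
  qed
  have "(\<lambda>n. LINT x|lborel. U x * g n x) \<longlonglongrightarrow> (LINT x|lborel. \<bar>U x\<bar>)"
  proof (rule integral_dominated_convergence[where w="\<lambda>x. \<bar>U x\<bar>"])
    show "AE x in lborel. (\<lambda>n. U x * g n x) \<longlonglongrightarrow> \<bar>U x\<bar>"
      using lim
    proof eventually_elim
      case (elim x)
      show ?case
      proof (cases "0 < x")
        case True
        then have "(\<lambda>n. U x * g n x) \<longlonglongrightarrow> U x * sgn (U x)"
          using elim by (intro tendsto_intros) auto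
        then show ?thesis
          by (simp add: abs_sgn)
      qed (simp add: U1)
    qed
    show "AE x in lborel. norm (U x * g n x) \<le> \<bar>U x\<bar>" for n
      using le[OF g(2)] by simp
  qed (use U in auto)
  then show ?thesis
    by (rule LIMSEQ_le_const2) (use bound in auto)
qed

section \<open>Polar coordinates and the squared radius\<close>

text \<open>Planar Lebesgue measure on the unit disc in the radial variable.\<close>

definition radial_measure :: "real measure" where
  "radial_measure = density lborel (\<lambda>r. ennreal (indicator {0<..<1} r * (2 * pi * r)))"

lemma sets_radial_measure [simp, measurable_cong]: "sets radial_measure = sets borel"
  by (simp add: radial_measure_def)

lemma space_radial_measure [simp]: "space radial_measure = UNIV"
  by (simp add: radial_measure_def)

lemma emeasure_radial_measure_greaterThan:
  "emeasure radial_measure {t<..} = ennreal (pi * (1 - (min 1 (max 0 t))\<^sup>2))"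
proof (cases "t < 1")
  case True
  define s where "s = max 0 t"
  have s: "0 \<le> s" "s < 1"
    using True by (auto simp: s_def)
  have hb: "has_bochner_integral lborel (\<lambda>r. indicator {s<..<1} r * (2 * pi * r)) (pi * 1\<^sup>2 - pi * s\<^sup>2)"
    by (rule has_bochner_integral_FTC_open)
      (use s in \<open>auto intro!: derivative_eq_intros continuous_intros\<close>)
  have "emeasure radial_measure {t<..} = (\<integral>\<^sup>+ r. ennreal (indicator {s<..<1} r * (2 * pi * r)) \<partial>lborel)"
    unfolding radial_measure_def
    by (subst emeasure_density) (auto intro!: nn_integral_cong simp: indicator_def s_def)
  also have "\<dots> = ennreal (pi * 1\<^sup>2 - pi * s\<^sup>2)"
    using hb s by (subst nn_integral_eq_integral) (auto simp: has_bochner_integral_iff indicator_def)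
  finally show ?thesis
    using True by (simp add: s_def algebra_simps min_def)
next
  case False
  have "emeasure radial_measure {t<..}
      = (\<integral>\<^sup>+ r. ennreal (indicator {0<..<1} r * (2 * pi * r)) * indicator {t<..} r \<partial>lborel)"
    unfolding radial_measure_def by (simp add: emeasure_density)
  also have "\<dots> = (\<integral>\<^sup>+ (r::real). 0 \<partial>lborel)"
    using False by (intro nn_integral_cong) (auto simp: indicator_def)
  finally have "emeasure radial_measure {t<..} = 0"
    by simp
  then show ?thesis
    using False by simp
qed

text \<open>Integration in polar coordinates for radial functions follows from the area of discs alone, since
the half-lines determine a finite measure on the real line.\<close>

lemma distr_norm_unit_disc:
  "distr (density lborel (indicator (ball 0 1 :: (real^2) set))) borel norm = radial_measure"
proof (rule measure_eqI_lessThan)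
  fix t :: real
  let ?B = "ball 0 1 :: (real^2) set"
  have eq: "emeasure (distr (density lborel (indicator ?B)) borel norm) {t<..}
      = emeasure lborel (?B - (if t < 0 then {} else cball 0 t))"
  proof -
    have [measurable]: "?B \<in> sets borel" "norm -` {t<..} \<in> sets (borel :: (real^2) measure)"
      by (auto intro!: borel_open open_vimage continuous_intros)
    have "emeasure (distr (density lborel (indicator ?B)) borel norm) {t<..}
        = emeasure (density lborel (indicator ?B)) (norm -` {t<..})"
      by (subst emeasure_distr) auto
    also have "\<dots> = (\<integral>\<^sup>+ x. indicator ?B x * indicator (norm -` {t<..}) x \<partial>lborel)"
      by (rule emeasure_density) simp_all
    also have "\<dots> = (\<integral>\<^sup>+ x. indicator (?B - (if t < 0 then {} else cball 0 t)) x \<partial>lborel)"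
    proof (rule nn_integral_cong)
      show "(indicator ?B x * indicator (norm -` {t<..}) x :: ennreal)
        = indicator (?B - (if t < 0 then {} else cball 0 t)) x" for x
      proof (cases "t < 0")
        case True
        then have "t < norm x"
          using norm_ge_zero[of x] by linarith
        then show ?thesis
          using True by (simp add: indicator_def)
      next
        case False
        then show ?thesis
          by (simp add: indicator_def not_le)
      qed
    qed
    also have "\<dots> = emeasure lborel (?B - (if t < 0 then {} else cball 0 t))"
      by (rule nn_integral_indicator) simp
    finally show ?thesis .
  qed
  have B: "emeasure lborel ?B = ennreal pi"
    by (simp add: emeasure_ball unit_ball_vol_2)
  show "emeasure (distr (density lborel (indicator ?B)) borel norm) {t<..} < \<infinity>"
    unfolding eq by (rule le_less_trans[OF emeasure_mono[of _ ?B]]) (auto simp: B)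
  consider "t < 0" | "0 \<le> t" "t < 1" | "1 \<le> t" by linarith
  then show "emeasure (distr (density lborel (indicator ?B)) borel norm) {t<..} = emeasure radial_measure {t<..}"
  proof cases
    case 1
    then show ?thesis
      unfolding eq emeasure_radial_measure_greaterThan by (simp add: B)
  next
    case 2
    have C: "emeasure lborel (cball 0 t :: (real^2) set) = ennreal (pi * t\<^sup>2)"
      using 2 by (simp add: emeasure_cball unit_ball_vol_2)
    have "emeasure lborel (?B - cball 0 t) = emeasure lborel ?B - emeasure lborel (cball 0 t :: (real^2) set)"
      using 2 C by (intro emeasure_Diff) auto
    also have "\<dots> = ennreal (pi * (1 - t\<^sup>2))"
      unfolding B C using 2 by (subst ennreal_minus) (auto simp: algebra_simps)
    finally show ?thesis
      unfolding eq emeasure_radial_measure_greaterThan using 2 by simp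
  next
    case 3
    then have "?B - cball 0 t = {}"
      by auto
    then have "emeasure lborel (?B - cball 0 t) = 0"
      by (simp only: emeasure_empty)
    then show ?thesis
      unfolding eq emeasure_radial_measure_greaterThan using 3 by simp
  qed
qed simp_all

text \<open>In the variable \<open>r\<^sup>2\<close> the area of discs grows linearly, so the planar measure becomes \<open>pi\<close> times
Lebesgue measure on \<open>(0,1)\<close>.\<close>

lemma distr_square_radial_measure:
  "distr radial_measure borel (\<lambda>r. r\<^sup>2) = density lborel (\<lambda>r. ennreal (pi * indicator {0<..<1} r))"
proof (rule measure_eqI_lessThan)
  fix t :: real
  have iff: "t < r\<^sup>2 \<longleftrightarrow> sqrt (max 0 t) < r" if "0 < r" for r
  proof -
    have "sqrt (max 0 t) < r \<longleftrightarrow> max 0 t < r\<^sup>2"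
      using that real_sqrt_less_iff[of "max 0 t" "r\<^sup>2"] by simp
    then show ?thesis
      using that by simp
  qed
  have "emeasure (distr radial_measure borel (\<lambda>r. r\<^sup>2)) {t<..} = emeasure radial_measure {sqrt (max 0 t)<..}"
  proof -
    have [measurable]: "(\<lambda>r::real. r\<^sup>2) -` {t<..} \<in> sets borel"
      by (auto intro!: borel_open open_vimage continuous_intros)
    have "emeasure (distr radial_measure borel (\<lambda>r. r\<^sup>2)) {t<..} = emeasure radial_measure ((\<lambda>r. r\<^sup>2) -` {t<..})"
      by (subst emeasure_distr) auto
    also have "\<dots> = (\<integral>\<^sup>+ r. ennreal (indicator {0<..<1} r * (2 * pi * r))
        * indicator ((\<lambda>r. r\<^sup>2) -` {t<..}) r \<partial>lborel)"
      unfolding radial_measure_def by (rule emeasure_density) simp_all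
    also have "\<dots> = (\<integral>\<^sup>+ r. ennreal (indicator {0<..<1} r * (2 * pi * r))
        * indicator {sqrt (max 0 t)<..} r \<partial>lborel)"
    proof (rule nn_integral_cong)
      show "ennreal (indicator {0<..<1} r * (2 * pi * r)) * indicator ((\<lambda>r. r\<^sup>2) -` {t<..}) r
        = ennreal (indicator {0<..<1} r * (2 * pi * r)) * indicator {sqrt (max 0 t)<..} r" for r :: real
      proof (cases "0 < r")
        case True
        show ?thesis
          by (simp only: indicator_def vimage_eq greaterThan_iff iff[OF True])
      qed simp
    qed
    also have "\<dots> = emeasure radial_measure {sqrt (max 0 t)<..}"
      unfolding radial_measure_def by (rule emeasure_density[symmetric]) simp_all
    finally show ?thesis .
  qed
  also have "\<dots> = ennreal (pi * (1 - min 1 (max 0 t)))"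
  proof -
    have "min 1 (sqrt s) ^ 2 = min 1 s" if "0 \<le> s" for s
      using that by (cases "s \<le> 1") (simp_all add: min_absorb1 min_absorb2)
    from this[of "max 0 t"] show ?thesis
      unfolding emeasure_radial_measure_greaterThan by (simp add: max_absorb2)
  qed
  finally have eq: "emeasure (distr radial_measure borel (\<lambda>r. r\<^sup>2)) {t<..} = ennreal (pi * (1 - min 1 (max 0 t)))" .
  then show "emeasure (distr radial_measure borel (\<lambda>r. r\<^sup>2)) {t<..} < \<infinity>"
    by simp
  have "emeasure (density lborel (\<lambda>r. ennreal (pi * indicator {0<..<1} r))) {t<..}
      = (\<integral>\<^sup>+ r. ennreal pi * indicator {max 0 t<..<1} r \<partial>lborel)"
    by (subst emeasure_density) (auto intro!: nn_integral_cong simp: indicator_def)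
  also have "\<dots> = ennreal pi * emeasure lborel {max 0 t<..<1}"
    by (subst nn_integral_cmult_indicator) auto
  also have "\<dots> = ennreal pi * ennreal (1 - min 1 (max 0 t))"
    by (cases "t < 1") (auto simp: min_def)
  also have "\<dots> = ennreal (pi * (1 - min 1 (max 0 t)))"
    by (subst ennreal_mult) auto
  finally show "emeasure (distr radial_measure borel (\<lambda>r. r\<^sup>2)) {t<..}
    = emeasure (density lborel (\<lambda>r. ennreal (pi * indicator {0<..<1} r))) {t<..}"
    unfolding eq by simp
qed simp_all

text \<open>The substitution \<open>r\<^sup>2\<close> in the form needed for functions that are not known to be integrable.\<close>

lemma
  fixes f :: "real \<Rightarrow> real"
  assumes [measurable]: "f \<in> borel_measurable borel"
  shows integrable_square_substitution: "integrable lborel (\<lambda>r. indicator {0<..<1} r * f r)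
      \<longleftrightarrow> integrable lborel (\<lambda>r. indicator {0<..<1} r * (2 * r * f (r\<^sup>2)))"
    and integral_square_substitution: "(LINT r|lborel. indicator {0<..<1} r * f r)
      = (LINT r|lborel. indicator {0<..<1} r * (2 * r * f (r\<^sup>2)))"
proof -
  let ?D = "density lborel (\<lambda>r. ennreal (pi * indicator {0<..<1} r))"
  have int: "integrable ?D f \<longleftrightarrow> integrable radial_measure (\<lambda>r. f (r\<^sup>2))"
    by (simp flip: distr_square_radial_measure add: integrable_distr_eq)
  have eq: "integral\<^sup>L ?D f = integral\<^sup>L radial_measure (\<lambda>r. f (r\<^sup>2))"
    by (simp flip: distr_square_radial_measure add: integral_distr)
  have 1: "integrable ?D f \<longleftrightarrow> integrable lborel (\<lambda>r. pi * (indicator {0<..<1} r * f r))"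
    "integral\<^sup>L ?D f = (LINT r|lborel. pi * (indicator {0<..<1} r * f r))"
    by (simp_all add: integrable_density integral_density mult_ac)
  have mult: "(indicator {0<..<1} r * (2 * pi * r)) *\<^sub>R f (r\<^sup>2) = pi * (indicator {0<..<1} r * (2 * r * f (r\<^sup>2)))" for r
    by simp
  have 2: "integrable radial_measure (\<lambda>r. f (r\<^sup>2))
      \<longleftrightarrow> integrable lborel (\<lambda>r. pi * (indicator {0<..<1} r * (2 * r * f (r\<^sup>2))))"
    unfolding radial_measure_def mult[symmetric] by (rule integrable_density) (auto simp: indicator_def)
  have 3: "integral\<^sup>L radial_measure (\<lambda>r. f (r\<^sup>2))
      = (LINT r|lborel. pi * (indicator {0<..<1} r * (2 * r * f (r\<^sup>2))))"
    unfolding radial_measure_def mult[symmetric] by (rule integral_density) (auto simp: indicator_def)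
  show "integrable lborel (\<lambda>r. indicator {0<..<1} r * f r)
      \<longleftrightarrow> integrable lborel (\<lambda>r. indicator {0<..<1} r * (2 * r * f (r\<^sup>2)))"
    using int unfolding 1 2 by simp
  show "(LINT r|lborel. indicator {0<..<1} r * f r)
      = (LINT r|lborel. indicator {0<..<1} r * (2 * r * f (r\<^sup>2)))"
    using eq unfolding 1 3 by simp
qed

section \<open>Interpolation for radial profiles\<close>

text \<open>With \<open>y = x\<^sup>2\<close>, \<open>dy = 2 x dx\<close>, this says that the Abel transform is integrable on \<open>(0,1)\<close>. It matters
because an infinite norm would be read as \<open>0\<close> on the right-hand side of the theorem.\<close>

lemma integrable_half_kernel_times_half_integral:
  assumes U: "integrable lborel U" and U0: "\<And>x. x \<notin> {0<..<1} \<Longrightarrow> U x = 0"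
  shows "integrable lborel (\<lambda>y. half_kernel y * half_integral U y)"
proof -
  have [measurable]: "U \<in> borel_measurable borel"
    using U by (auto dest: borel_measurable_integrable)
  have conv: "has_bochner_integral lborel (\<lambda>y. half_kernel (x - y) * half_kernel y) (if 0 < x then pi else 0)" for x
    using has_bochner_integral_half_kernel_convolution[of x 0] by simp
  have "integrable (lborel \<Otimes>\<^sub>M lborel) (\<lambda>(x, y). U x * (half_kernel (x - y) * half_kernel y))"
  proof (rule lborel_pair.Fubini_integrable)
    have "(LINT y|lborel. norm (case (x, y) of (x, y) \<Rightarrow> U x * (half_kernel (x - y) * half_kernel y))) = pi * \<bar>U x\<bar>" for x
      using conv[of x] U0[of x] by (simp add: abs_mult has_bochner_integral_iff)
    then show "integrable lborel (\<lambda>x. LINT y|lborel. norm (case (x, y) of (x, y) \<Rightarrow> U x * (half_kernel (x - y) * half_kernel y)))"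
      using U by simp
    show "AE x in lborel. integrable lborel (\<lambda>y. case (x, y) of (x, y) \<Rightarrow> U x * (half_kernel (x - y) * half_kernel y))"
      using conv by (auto simp: has_bochner_integral_iff)
  qed simp
  then have "integrable lborel (\<lambda>y. LINT x|lborel. U x * (half_kernel (x - y) * half_kernel y))"
    by (rule lborel_pair.integrable_snd)
  moreover have "(LINT x|lborel. U x * (half_kernel (x - y) * half_kernel y)) = half_kernel y * half_integral U y" for y
    unfolding half_integral_def by (simp flip: integral_mult_right_zero add: mult_ac)
  ultimately show ?thesis
    by simp
qed

text \<open>The two terms balance at \<open>h = (N / T) powr (2/3)\<close>; if \<open>T\<close> or \<open>N\<close> vanishes, let \<open>h\<close> tend to \<open>\<infinity>\<close> or
to \<open>0\<close>.\<close>

lemma le_powr_of_forall_tradeoff: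
  fixes T N X c :: real
  assumes T: "0 \<le> T" and N: "0 \<le> N"
    and le: "\<And>h. 0 < h \<Longrightarrow> X \<le> h * T + c / sqrt h * N"
  shows "X \<le> (1 + c) * T powr (1/3) * N powr (2/3)"
proof (cases "T = 0 \<or> N = 0")
  case True
  have "X \<le> 0"
  proof (cases "T = 0")
    case True
    have "((\<lambda>h. c / sqrt h * N) \<longlongrightarrow> 0) at_top"
      by (intro tendsto_mult_left_zero tendsto_divide_0[OF tendsto_const]
          filterlim_at_top_imp_at_infinity sqrt_at_top)
    then show ?thesis
      by (rule tendsto_lowerbound) (use le True in \<open>auto intro: eventually_mono[OF eventually_gt_at_top[of 0]]\<close>)
  next
    case False
    then have "N = 0"
      using \<open>T = 0 \<or> N = 0\<close> by simp
    have "((\<lambda>h. h * T) \<longlongrightarrow> 0 * T) (at_right 0)"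
      by (intro tendsto_intros)
    then have "X \<le> 0 * T"
      by (rule tendsto_lowerbound)
        (use le \<open>N = 0\<close> in \<open>auto intro: eventually_mono[OF eventually_at_right_less[of 0]]\<close>)
    then show ?thesis
      by simp
  qed
  then show ?thesis
    using True by auto
next
  case False
  then have pos: "0 < T" "0 < N"
    using T N by auto
  define h where "h = (N / T) powr (2/3)"
  have h: "0 < h"
    using pos by (simp add: h_def)
  have "T = T powr (1/3) * T powr (2/3)" "N = N powr (1/3) * N powr (2/3)"
    using pos by (simp_all flip: powr_add)
  have "h * T = T powr (1/3) * N powr (2/3)"
  proof -
    have "h * T = N powr (2/3) / T powr (2/3) * (T powr (1/3) * T powr (2/3))"
      using pos \<open>T = _\<close> by (simp add: h_def powr_divide)
    then show ?thesis
      using pos by simp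
  qed
  moreover have "c / sqrt h * N = c * (T powr (1/3) * N powr (2/3))"
  proof -
    have "sqrt h = (N / T) powr (1/3)"
      using h by (simp add: h_def powr_powr flip: powr_half_sqrt)
    then have "c / sqrt h * N = c * T powr (1/3) / N powr (1/3) * (N powr (1/3) * N powr (2/3))"
      using pos \<open>N = _\<close> by (simp add: powr_divide)
    then show ?thesis
      using pos by simp
  qed
  ultimately show ?thesis
    using le[OF h] by (simp add: algebra_simps)
qed

text \<open>The variation does not increase under the substitution \<open>r\<^sup>2\<close>: a test function in the new variable
yields one in the old variable with the same bound.\<close>

lemma signed_square_pullback_test_function:
  fixes \<theta> D :: "real \<Rightarrow> real"
  assumes \<theta>: "\<And>x. (\<theta> has_real_derivative D x) (at x)" "continuous_on UNIV D"
    and ac: "0 < a" "c < 1" "\<And>x. x \<notin> {a<..<c} \<Longrightarrow> \<theta> x = 0" and le: "\<And>x. \<bar>\<theta> x\<bar> \<le> 1"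
  shows "(\<lambda>r. \<theta> (r * \<bar>r\<bar>)) \<in> TV_test_functions"
    and "deriv (\<lambda>r. \<theta> (r * \<bar>r\<bar>)) r = D (r * \<bar>r\<bar>) * (2 * \<bar>r\<bar>)"
proof -
  have der: "((\<lambda>r. \<theta> (r * \<bar>r\<bar>)) has_real_derivative D (r * \<bar>r\<bar>) * (2 * \<bar>r\<bar>)) (at r)" for r
    by (rule DERIV_chain2[where f=\<theta> and g="\<lambda>r. r * \<bar>r\<bar>", OF \<theta>(1) has_real_derivative_signed_square])
  then show "deriv (\<lambda>r. \<theta> (r * \<bar>r\<bar>)) r = D (r * \<bar>r\<bar>) * (2 * \<bar>r\<bar>)"
    by (rule DERIV_imp_deriv)
  have "continuous_on UNIV (\<lambda>r. D (r * \<bar>r\<bar>) * (2 * \<bar>r\<bar>))"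
    by (intro continuous_intros continuous_on_compose2[OF \<theta>(2)]) auto
  then have "(\<lambda>r. \<theta> (r * \<bar>r\<bar>)) C1_differentiable_on UNIV"
    unfolding C1_differentiable_on_def
    by (intro exI[of _ "\<lambda>r. D (r * \<bar>r\<bar>) * (2 * \<bar>r\<bar>)"] conjI ballI
        der[unfolded has_real_derivative_iff_has_vector_derivative])
  moreover have "closure {r. \<theta> (r * \<bar>r\<bar>) \<noteq> 0} \<subseteq> {sqrt a..sqrt c}"
  proof (rule closure_minimal)
    show "{r. \<theta> (r * \<bar>r\<bar>) \<noteq> 0} \<subseteq> {sqrt a..sqrt c}"
    proof
      fix r
      assume "r \<in> {r. \<theta> (r * \<bar>r\<bar>) \<noteq> 0}"
      then have r: "a < r * \<bar>r\<bar>" "r * \<bar>r\<bar> < c"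
        using ac(3)[of "r * \<bar>r\<bar>"] by auto
      then have "0 < r"
        using ac(1) by (smt (verit) mult_nonpos_nonneg)
      then show "r \<in> {sqrt a..sqrt c}"
        using r by (auto intro!: real_le_lsqrt real_le_rsqrt simp: power2_eq_square)
    qed
  qed simp
  moreover have "{sqrt a..sqrt c} \<subseteq> {0<..<1}"
  proof -
    have "0 < sqrt a" "sqrt c < 1"
      using ac(1,2) by simp_all
    then show ?thesis
      by (meson atLeastAtMost_iff greaterThanLessThan_iff le_less_trans less_le_trans subsetI)
  qed
  ultimately show "(\<lambda>r. \<theta> (r * \<bar>r\<bar>)) \<in> TV_test_functions"
    using le unfolding TV_test_functions_def by blast
qed

text \<open>The estimate for a radial profile, obtained from the one-dimensional estimate for
\<open>U(x) = v (sqrt x)\<close>. The factor \<open>2\<close> between the norms of \<open>half_integral U\<close> and \<open>f\<close>, from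
\<open>dy = 2 x dx \<le> 2 dx\<close>, turns the constant \<open>4 / pi\<close> into \<open>8 / pi\<close>.\<close>

lemma radial_interpolation:
  fixes v f :: "real \<Rightarrow> real"
  assumes v: "integrable lborel v" and b: "0 < b" "b < 1" and v0: "\<And>r. r \<notin> {0<..<b} \<Longrightarrow> v r = 0"
    and T: "0 \<le> T" and test: "\<And>\<phi>. \<phi> \<in> TV_test_functions \<Longrightarrow> (LINT r|lborel. v r * deriv \<phi> r) \<le> T"
    and f: "\<And>x. x \<in> {0<..<1} \<Longrightarrow> f x = 2 * (LINT r|lborel. v r * r * half_kernel (r\<^sup>2 - x\<^sup>2))"
  shows "integrable lborel (\<lambda>x. indicator {0<..<1} x * \<bar>f x\<bar>)" (is ?int)
    and "integrable lborel (\<lambda>r. 2 * r * \<bar>v r\<bar>)"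
    and "(LINT r|lborel. 2 * r * \<bar>v r\<bar>)
      \<le> (1 + 8 / pi) * T powr (1/3) * (LINT x|lborel. indicator {0<..<1} x * \<bar>f x\<bar>) powr (2/3)"
proof -
  have [measurable]: "v \<in> borel_measurable borel"
    using v by (auto dest: borel_measurable_integrable)
  define U where "U x = v (sqrt x)" for x
  have [measurable]: "U \<in> borel_measurable borel"
    unfolding U_def by measurable
  have U0: "U x = 0" if "x \<notin> {0<..<b\<^sup>2}" for x
  proof -
    have "sqrt x \<notin> {0<..<b}"
      using that b real_sqrt_less_iff[of x "b\<^sup>2"] by auto
    then show ?thesis
      by (simp add: U_def v0)
  qed
  have b2: "0 < b\<^sup>2" "b\<^sup>2 < 1"
    using b by (simp_all add: abs_square_less_1)
  have U1: "U x = 0" if "x \<notin> {0<..<1}" for x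
    using U0[of x] that b2 by auto
  have indU: "indicator {0<..<1} x * (U x * w) = U x * w" for x w
    using U1[of x] by (auto simp: indicator_def)
  have indv: "indicator {0<..<1} r * (2 * r * (U (r\<^sup>2) * w)) = 2 * r * (v r * w)" for r w
    using v0[of r] b by (auto simp: U_def indicator_def)
  have subst: "integrable lborel (\<lambda>x. U x * w x) \<longleftrightarrow> integrable lborel (\<lambda>r. 2 * r * (v r * w (r\<^sup>2)))"
    "(LINT x|lborel. U x * w x) = (LINT r|lborel. 2 * r * (v r * w (r\<^sup>2)))"
    if [measurable]: "w \<in> borel_measurable borel" for w
    using integrable_square_substitution[of "\<lambda>x. U x * w x"] integral_square_substitution[of "\<lambda>x. U x * w x"]
    unfolding indU indv by simp_all
  have int_v: "integrable lborel (\<lambda>r. 2 * r * (v r * 1))"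
  proof (rule Bochner_Integration.integrable_bound)
    show "integrable lborel (\<lambda>r. 2 * v r)"
      using v by simp
    show "AE r in lborel. norm (2 * r * (v r * 1)) \<le> norm (2 * v r)"
    proof (rule AE_I2)
      show "norm (2 * r * (v r * 1)) \<le> norm (2 * v r)" for r
        using v0[of r] b by (cases "r \<in> {0<..<b}") (auto simp: abs_mult intro!: mult_left_le_one_le)
    qed
  qed simp
  show "integrable lborel (\<lambda>r. 2 * r * \<bar>v r\<bar>)"
  proof (rule Bochner_Integration.integrable_bound[OF int_v])
    show "AE r in lborel. norm (2 * r * \<bar>v r\<bar>) \<le> norm (2 * r * (v r * 1))"
      by (simp add: abs_mult)
  qed simp
  have U: "integrable lborel U"
    using int_v subst(1)[of "\<lambda>_. 1"] by simp
  have F: "half_integral U (x\<^sup>2) = f x" if "x \<in> {0<..<1}" for x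
    unfolding half_integral_def f[OF that]
    by (subst subst(2)) (simp_all flip: integral_mult_right_zero add: mult_ac)
  have [measurable]: "half_integral U \<in> borel_measurable borel"
    unfolding half_integral_def by measurable
  have "integrable lborel (\<lambda>y. indicator {0<..<1} y * (half_kernel y * \<bar>half_integral U y\<bar>))"
  proof (rule Bochner_Integration.integrable_bound[OF integrable_half_kernel_times_half_integral[OF U U1]])
    show "AE y in lborel. norm (indicator {0<..<1} y * (half_kernel y * \<bar>half_integral U y\<bar>))
      \<le> norm (half_kernel y * half_integral U y)"
      by (auto simp: indicator_def abs_mult)
  qed simp_all
  then have "integrable lborel (\<lambda>x. indicator {0<..<1} x * (2 * x * (half_kernel (x\<^sup>2) * \<bar>half_integral U (x\<^sup>2)\<bar>)))"
    by (subst (asm) integrable_square_substitution) simp_all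
  moreover have "indicator {0<..<1} x * (2 * x * (half_kernel (x\<^sup>2) * \<bar>half_integral U (x\<^sup>2)\<bar>))
      = 2 * (indicator {0<..<1} x * \<bar>f x\<bar>)" for x
    using F[of x] by (auto simp: indicator_def half_kernel_def)
  ultimately have "integrable lborel (\<lambda>x. 2 * (indicator {0<..<1} x * \<bar>f x\<bar>))"
    by simp
  then show int: ?int
    by simp
  let ?N = "LINT x|lborel. indicator {0<..<1} x * \<bar>f x\<bar>"
  have S: "(LINT y|lborel. indicator {0<..<1} y * \<bar>half_integral U y\<bar>) \<le> 2 * ?N"
  proof -
    have "(LINT y|lborel. indicator {0<..<1} y * \<bar>half_integral U y\<bar>)
        = (LINT x|lborel. indicator {0<..<1} x * (2 * x * \<bar>half_integral U (x\<^sup>2)\<bar>))"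
      by (rule integral_square_substitution) simp
    also have "\<dots> = (LINT x|lborel. indicator {0<..<1} x * (2 * x * \<bar>f x\<bar>))"
      by (rule Bochner_Integration.integral_cong) (auto simp: indicator_def F)
    also have "\<dots> \<le> (LINT x|lborel. 2 * (indicator {0<..<1} x * \<bar>f x\<bar>))"
    proof (rule integral_mono')
      show "indicator {0<..<1} x * (2 * x * \<bar>f x\<bar>) \<le> 2 * (indicator {0<..<1} x * \<bar>f x\<bar>)" for x
        by (auto simp: indicator_def mult_left_le_one_le)
    qed (use int in auto)
    finally show ?thesis
      by simp
  qed
  have testU: "(LINT x|lborel. U x * D x) \<le> T"
    if \<theta>: "\<And>x. (\<theta> has_real_derivative D x) (at x)" "continuous_on UNIV D" "0 < a" "c < 1"
      "\<And>x. x \<notin> {a<..<c} \<Longrightarrow> \<theta> x = 0" "\<And>x. \<bar>\<theta> x\<bar> \<le> 1" for \<theta> D :: "real \<Rightarrow> real" and a c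
  proof -
    have [measurable]: "D \<in> borel_measurable borel"
      using \<theta>(2) by (rule borel_measurable_continuous_onI)
    have test_\<phi>: "(\<lambda>r. \<theta> (r * \<bar>r\<bar>)) \<in> TV_test_functions"
      and deriv_\<phi>: "deriv (\<lambda>r. \<theta> (r * \<bar>r\<bar>)) r = D (r * \<bar>r\<bar>) * (2 * \<bar>r\<bar>)" for r
      by (rule signed_square_pullback_test_function[OF \<theta>]; assumption)+
    have "(LINT x|lborel. U x * D x) = (LINT r|lborel. 2 * r * (v r * D (r\<^sup>2)))"
      by (rule subst(2)) simp
    also have "\<dots> = (LINT r|lborel. v r * deriv (\<lambda>r. \<theta> (r * \<bar>r\<bar>)) r)"
    proof (rule Bochner_Integration.integral_cong[OF refl])
      show "2 * r * (v r * D (r\<^sup>2)) = v r * deriv (\<lambda>r. \<theta> (r * \<bar>r\<bar>)) r" for r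
        unfolding deriv_\<phi> using v0[of r] by (cases "r \<in> {0<..<b}") (auto simp: power2_eq_square)
    qed
    also have "\<dots> \<le> T"
      by (rule test[OF test_\<phi>])
    finally show ?thesis .
  qed
  have "(LINT r|lborel. 2 * r * \<bar>v r\<bar>) = (LINT x|lborel. \<bar>U x\<bar>)"
  proof -
    have absU: "\<bar>U x\<bar> = U x * sgn (U x)" for x
      by (rule abs_sgn)
    have absv: "2 * r * \<bar>v r\<bar> = 2 * r * (v r * sgn (U (r\<^sup>2)))" for r
      using v0[of r] by (cases "r \<in> {0<..<b}") (auto simp: abs_sgn U_def)
    show ?thesis
      unfolding absU absv by (rule subst(2)[symmetric]) simp
  qed
  also have "\<dots> \<le> (1 + 8 / pi) * T powr (1/3) * ?N powr (2/3)"
  proof (rule le_powr_of_forall_tradeoff[OF T])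
    show "(LINT x|lborel. \<bar>U x\<bar>) \<le> h * T + 8 / pi / sqrt h * ?N" if h: "0 < h" for h
    proof -
      have "(LINT x|lborel. \<bar>U x\<bar>) \<le> h * T
          + 4 / pi / sqrt h * (LINT y|lborel. indicator {0<..<1} y * \<bar>half_integral U y\<bar>)"
        using U b2 U0 testU h by (rule L1_le_variation_plus_half_integral)
      also have "\<dots> \<le> h * T + 4 / pi / sqrt h * (2 * ?N)"
        using h by (intro add_left_mono mult_left_mono S) auto
      finally show ?thesis
        by simp
    qed
  qed (auto intro!: Bochner_Integration.integral_nonneg simp: indicator_def)
  finally show "(LINT r|lborel. 2 * r * \<bar>v r\<bar>) \<le> (1 + 8 / pi) * T powr (1/3) * ?N powr (2/3)" .
qed

section \<open>The estimate on the disc\<close>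

lemma radial_profile_norm:
  assumes "axisymmetric u" "x \<in> ball 0 1"
  shows "radial_profile u (norm x) = u x"
proof -
  let ?y = "norm x *\<^sub>R axis 1 1 :: real^2"
  have "norm ?y = norm x" "?y \<in> ball 0 1"
    using assms(2) by simp_all
  then have "u ?y = u x"
    using assms unfolding axisymmetric_def by blast
  then show ?thesis
    using assms(2) by (simp add: radial_profile_def)
qed

text \<open>The product-measure arguments need Borel functions, while the profile is only Lebesgue measurable
and its support is only described up to null sets; replacing it by an almost everywhere equal
function changes no integral in the statement.\<close>

lemma ex_borel_representative_of_profile:
  fixes w :: "real \<Rightarrow> real"
  assumes int: "set_integrable lebesgue {0<..<1} w"
    and w0: "\<And>r. r \<notin> {0..<1} \<Longrightarrow> w r = 0" and supp: "ess_support w \<subseteq> {0..<1}"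
  obtains v b where "integrable lborel v" "0 < b" "b < 1" "\<And>r. r \<notin> {0<..<b} \<Longrightarrow> v r = 0"
    "AE r in lborel. w r = v r" "w \<in> borel_measurable lebesgue"
proof -
  have "1 \<notin> ess_support w"
    using supp by auto
  then obtain S where S: "open S" "1 \<in> S" and AE_S: "AE r in lebesgue. r \<in> S \<longrightarrow> w r = 0"
    by (auto simp: ess_support_def)
  obtain e where e: "0 < e" "ball 1 e \<subseteq> S"
    using S by (auto simp: open_contains_ball)
  define b where "b = max (1 / 2) (1 - e / 2)"
  have b: "0 < b" "b < 1" "1 - b < e"
    using e by (auto simp: b_def)
  have int': "integrable lebesgue (\<lambda>r. indicator {0<..<1} r * w r)"
    using int by (simp add: set_integrable_def)
  then obtain g where g[measurable]: "g \<in> borel_measurable lborel"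
    and AE_g: "AE r in lborel. indicator {0<..<1} r * w r = g r"
    using completion_ex_borel_measurable_real[OF borel_measurable_integrable[OF int']] by blast
  have "integrable lebesgue g"
    by (rule integrable_cong_AE_imp[OF int' measurable_completion[OF g]])
      (use AE_completion[OF AE_g] in \<open>auto elim: eventually_mono\<close>)
  then have int_g: "integrable lborel g"
    using integrable_completion[OF g] by simp
  show thesis
  proof (rule that)
    show "integrable lborel (\<lambda>r. indicator {0<..<b} r * g r)"
      using integrable_mult_indicator[OF _ int_g, of "{0<..<b}"] by simp
    show "AE r in lborel. w r = indicator {0<..<b} r * g r"
      using AE_g AE_S[unfolded AE_completion_iff] AE_lborel_singleton[of 0] AE_lborel_singleton[of b]
    proof eventually_elim
      case (elim r)
      \<comment> \<open>The four cases use the extension by zero, the representative \<open>g\<close>, the support near \<open>1\<close> and the extension by zero again.\<close>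
      consider "r < 0" | "0 < r" "r < b" | "b < r" "r < 1" | "1 \<le> r"
        using elim by linarith
      then show ?case
      proof cases
        case 3
        then have "r \<in> S"
          using e b by (auto simp: dist_real_def)
        then show ?thesis
          using elim 3 by simp
      qed (use elim w0 b in auto)
    qed
    have "(\<lambda>r. indicator {0<..<1} r * w r + indicator {0} r * w 0) \<in> borel_measurable lebesgue"
      by (intro borel_measurable_add borel_measurable_integrable[OF int'] measurable_completion) simp_all
    moreover have "(\<lambda>r. indicator {0<..<1} r * w r + indicator {0} r * w 0) = w"
    proof
      show "indicator {0<..<1} r * w r + indicator {0} r * w 0 = w r" for r
        using w0[of r] by (cases "r \<in> {0..<1}") (auto simp: indicator_def)
    qed
    ultimately show "w \<in> borel_measurable lebesgue"
      by simp
  qed (use b in auto)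
qed

theorem theoremA4:
  shows "\<exists>C::real. \<forall>(u :: real^2 \<Rightarrow> real) (f :: real \<Rightarrow> real).
    axisymmetric u \<longrightarrow>
    BV_unit_interval (radial_profile u) \<longrightarrow>
    ess_support (radial_profile u) \<subseteq> {0..<1} \<longrightarrow>
    (\<forall>x\<ge>0. abel_transform (radial_profile u) x = f x) \<longrightarrow>
    L1_norm (ball 0 1) u \<le>
      ennreal (C * enn2real (TV_norm (radial_profile u)) powr (1/3)
                 * enn2real (L1_norm {0<..<1} f) powr (2/3))"
proof (intro exI[of _ "pi + 8"] allI impI)
  fix u :: "real^2 \<Rightarrow> real" and f :: "real \<Rightarrow> real"
  assume ax: "axisymmetric u" and BV: "BV_unit_interval (radial_profile u)"
    and supp: "ess_support (radial_profile u) \<subseteq> {0..<1}"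
    and abel: "\<forall>x\<ge>0. abel_transform (radial_profile u) x = f x"
  let ?w = "radial_profile u"
  define T where "T = enn2real (TV_norm ?w)"
  have T: "0 \<le> T" "TV_norm ?w = ennreal T"
    using BV by (auto simp: T_def BV_unit_interval_def)
  have w0: "?w r = 0" if "r \<notin> {0..<1}" for r
    using that by (auto simp: radial_profile_def)
  have w_int: "set_integrable lebesgue {0<..<1} ?w"
    using BV by (simp add: BV_unit_interval_def)
  obtain v b where v: "integrable lborel v" and b: "0 < b" "b < 1"
    and v0: "\<And>r. r \<notin> {0<..<b} \<Longrightarrow> v r = 0"
    and w_v: "AE r in lborel. ?w r = v r" and w_meas: "?w \<in> borel_measurable lebesgue"
    by (rule ex_borel_representative_of_profile[OF w_int w0 supp]) (assumption, rule that)
  have [measurable]: "v \<in> borel_measurable borel"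
    using v by (auto dest: borel_measurable_integrable)
  have LINT_w: "(LINT r|lebesgue. ?w r * g r) = (LINT r|lborel. v r * g r)"
    if g[measurable]: "g \<in> borel_measurable borel" for g
  proof -
    have g': "g \<in> borel_measurable lebesgue" "v \<in> borel_measurable lebesgue"
      by (rule measurable_completion; simp)+
    have "(LINT r|lebesgue. ?w r * g r) = (LINT r|lebesgue. v r * g r)"
      by (rule integral_cong_AE)
        (use w_meas g' AE_completion[OF w_v] in \<open>auto elim: eventually_mono\<close>)
    also have "\<dots> = (LINT r|lborel. v r * g r)"
      by (rule integral_completion) simp
    finally show ?thesis .
  qed
  have test: "(LINT r|lborel. v r * deriv \<phi> r) \<le> T" if \<phi>: "\<phi> \<in> TV_test_functions" for \<phi>
  proof -
    obtain D where D: "\<And>r. (\<phi> has_real_derivative D r) (at r)" "continuous_on UNIV D"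
      using \<phi> by (auto simp: TV_test_functions_def C1_differentiable_on_def
          has_real_derivative_iff_has_vector_derivative)
    have "deriv \<phi> = D"
      using D(1) by (auto intro: DERIV_imp_deriv)
    then have [measurable]: "deriv \<phi> \<in> borel_measurable borel"
      using D(2) by (simp add: borel_measurable_continuous_onI)
    have "(LINT r:{0<..<1}|lebesgue. ?w r * deriv \<phi> r) = (LINT r|lebesgue. ?w r * (indicator {0<..<1} r * deriv \<phi> r))"
      by (simp add: set_lebesgue_integral_def mult_ac)
    also have "\<dots> = (LINT r|lborel. v r * (indicator {0<..<1} r * deriv \<phi> r))"
      by (rule LINT_w) simp
    also have "\<dots> = (LINT r|lborel. v r * deriv \<phi> r)"
    proof (rule Bochner_Integration.integral_cong[OF refl])
      show "v r * (indicator {0<..<1} r * deriv \<phi> r) = v r * deriv \<phi> r" for r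
        using v0[of r] b by (cases "r \<in> {0<..<b}") auto
    qed
    finally have "ennreal (LINT r|lborel. v r * deriv \<phi> r) \<le> TV_norm ?w"
      unfolding TV_norm_def using \<phi> by (metis (no_types, lifting) SUP_upper)
    then show ?thesis
      using T by simp
  qed
  have f_eq: "f x = 2 * (LINT r|lborel. v r * r * half_kernel (r\<^sup>2 - x\<^sup>2))" if x: "x \<in> {0<..<1}" for x
  proof -
    have "f x = abel_transform ?w x"
      using abel x by simp
    also have "\<dots> = 2 * (LINT r|lebesgue. ?w r * (indicator {x..} r * (r / sqrt (r\<^sup>2 - x\<^sup>2))))"
      by (simp add: abel_transform_def set_lebesgue_integral_def mult_ac)
    also have "\<dots> = 2 * (LINT r|lborel. v r * (indicator {x..} r * (r / sqrt (r\<^sup>2 - x\<^sup>2))))"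
      by (subst LINT_w) simp_all
    also have "(LINT r|lborel. v r * (indicator {x..} r * (r / sqrt (r\<^sup>2 - x\<^sup>2))))
        = (LINT r|lborel. v r * r * half_kernel (r\<^sup>2 - x\<^sup>2))"
    proof (rule Bochner_Integration.integral_cong[OF refl])
      fix r
      show "v r * (indicator {x..} r * (r / sqrt (r\<^sup>2 - x\<^sup>2))) = v r * r * half_kernel (r\<^sup>2 - x\<^sup>2)"
      proof (cases "r \<in> {0<..<b}")
        case True
        then have "x\<^sup>2 < r\<^sup>2 \<longleftrightarrow> x < r"
          using x power_strict_mono[of x r 2] power_less_imp_less_base[of x 2 r] by auto
        then show ?thesis
          by (auto simp: half_kernel_def indicator_def)
      qed (simp add: v0)
    qed
    finally show ?thesis .
  qed
  note core = radial_interpolation[OF v b v0 T(1) test f_eq]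
  have N: "L1_norm {0<..<1} f = ennreal (LINT x|lborel. indicator {0<..<1} x * \<bar>f x\<bar>)"
  proof -
    have "L1_norm {0<..<1} f = (\<integral>\<^sup>+ x. ennreal (indicator {0<..<1} x * \<bar>f x\<bar>) \<partial>lborel)"
      unfolding L1_norm_def nn_integral_completion
      by (intro nn_integral_cong) (auto simp: indicator_def)
    then show ?thesis
      using core(1) by (subst (asm) nn_integral_eq_integral) auto
  qed
  \<comment> \<open>Null sets of radii are null sets of the disc, so the profile may be replaced by \<open>v\<close> under the planar integral as well.\<close>
  have "AE r in radial_measure. ?w r = v r"
    using w_v unfolding radial_measure_def by (subst AE_density) (auto elim: eventually_mono)
  then have AE_disc: "AE x in density lborel (indicator (ball 0 1 :: (real^2) set)). ?w (norm x) = v (norm x)"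
    unfolding distr_norm_unit_disc[symmetric] by (rule AE_distrD[rotated]) simp
  have disc_meas: "(indicator (ball 0 1) :: real^2 \<Rightarrow> ennreal) \<in> borel_measurable lborel"
    by (rule borel_measurable_indicator) simp
  have "L1_norm (ball 0 1) u = (\<integral>\<^sup>+ (x :: real^2). ennreal \<bar>v (norm x)\<bar> * indicator (ball 0 1) x \<partial>lborel)"
    unfolding L1_norm_def nn_integral_completion
  proof (rule nn_integral_cong_AE)
    have "AE x in lborel. 0 < (indicator (ball 0 1) (x :: real^2) :: ennreal) \<longrightarrow> ?w (norm x) = v (norm x)"
      using AE_disc unfolding AE_density[OF disc_meas] .
    then show "AE x in lborel. ennreal \<bar>u x\<bar> * indicator (ball 0 1) x = ennreal \<bar>v (norm x)\<bar> * indicator (ball 0 1) x"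
    proof eventually_elim
      case (elim x)
      then show ?case
        using radial_profile_norm[OF ax, of x] by (cases "x \<in> ball 0 1") auto
    qed
  qed
  also have "\<dots> = (\<integral>\<^sup>+ x. ennreal \<bar>v (norm x)\<bar> \<partial>density lborel (indicator (ball 0 1 :: (real^2) set)))"
    by (subst nn_integral_density[OF disc_meas]) (simp_all add: mult_ac)
  also have "\<dots> = (\<integral>\<^sup>+ r. ennreal \<bar>v r\<bar> \<partial>radial_measure)"
    unfolding distr_norm_unit_disc[symmetric] by (subst nn_integral_distr) auto
  also have "\<dots> = (\<integral>\<^sup>+ r. ennreal (pi * (2 * r * \<bar>v r\<bar>)) \<partial>lborel)"
    unfolding radial_measure_def
  proof (subst nn_integral_density)
    show "(\<integral>\<^sup>+ r. ennreal (indicator {0<..<1} r * (2 * pi * r)) * ennreal \<bar>v r\<bar> \<partial>lborel)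
      = (\<integral>\<^sup>+ r. ennreal (pi * (2 * r * \<bar>v r\<bar>)) \<partial>lborel)"
    proof (rule nn_integral_cong)
      show "ennreal (indicator {0<..<1} r * (2 * pi * r)) * ennreal \<bar>v r\<bar> = ennreal (pi * (2 * r * \<bar>v r\<bar>))" for r
        using v0[of r] b by (cases "r \<in> {0<..<b}") (simp_all add: mult_ac flip: ennreal_mult)
    qed
  qed simp_all
  also have "\<dots> = ennreal (LINT r|lborel. pi * (2 * r * \<bar>v r\<bar>))"
  proof (rule nn_integral_eq_integral)
    show "AE r in lborel. 0 \<le> pi * (2 * r * \<bar>v r\<bar>)"
    proof (rule AE_I2)
      show "0 \<le> pi * (2 * r * \<bar>v r\<bar>)" for r
        using v0[of r] by (cases "r \<in> {0<..<b}") auto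
    qed
  qed (use core(2) in simp)
  also have "\<dots> = ennreal (pi * (LINT r|lborel. 2 * r * \<bar>v r\<bar>))"
    by simp
  also have "\<dots> \<le> ennreal (pi * ((1 + 8 / pi) * T powr (1/3) * (LINT x|lborel. indicator {0<..<1} x * \<bar>f x\<bar>) powr (2/3)))"
    by (intro ennreal_leI mult_left_mono core(3) pi_ge_zero)
  also have "(LINT x|lborel. indicator {0<..<1} x * \<bar>f x\<bar>) = enn2real (L1_norm {0<..<1} f)"
    unfolding N by (rule enn2real_ennreal[symmetric]) (auto intro!: Bochner_Integration.integral_nonneg)
  also have "pi * ((1 + 8 / pi) * T powr (1/3) * enn2real (L1_norm {0<..<1} f) powr (2/3))
      = (pi + 8) * T powr (1/3) * enn2real (L1_norm {0<..<1} f) powr (2/3)"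
    by (simp add: field_simps)
  finally show "L1_norm (ball 0 1) u \<le> ennreal ((pi + 8) * enn2real (TV_norm ?w) powr (1/3)
                 * enn2real (L1_norm {0<..<1} f) powr (2/3))"
    unfolding T_def .
qed

end
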